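(* Let $(M,g)$ be a Riemannian manifold, endowed with its Riemannian distance $d$. Let $k\ge1$ be a real number and let $\gamma:[a,b]\to M$ be a curve of class m-$\mathcal{C}^1_k$ such that $t\mapsto\mathrm{meas}^k_t(\gamma)$ does not vanish identically on $[a,b]$. Then $k=1$.
   Context: A continuous curve $\gamma:[a,b]\to M$ in a metric space $(M,d)$ is m-differentiable of degree $k$ at $t\in[a,b]$ if $\lim_{s\to0,\ t+s\in[a,b]} d(\gamma(t+s),\gamma(t))/|s|^{1/k}$ exists and is finite; then $\mathrm{meas}^k_t(\gamma)$ denotes the $k$-th power of this limit. The curve is of class m-$\mathcal{C}^1_k$ if it is m-differentiable of degree $k$ at every $t\in[a,b]$ and $t\mapsto\mathrm{meas}^k_t(\gamma)$ is continuous on $[a,b]$. *)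

theory Defs
  imports "HOL-Analysis.Analysis"
begin

section \<open>Curves of class m-C1 in a metric space\<close>

definition m_quotient ::
  "('a \<Rightarrow> 'a \<Rightarrow> real) \<Rightarrow> real \<Rightarrow> (real \<Rightarrow> 'a) \<Rightarrow> real \<Rightarrow> real \<Rightarrow> real" where
  "m_quotient d k \<gamma> t s = d (\<gamma> (t + s)) (\<gamma> t) / \<bar>s\<bar> powr (1 / k)"

definition m_differentiable ::
  "('a \<Rightarrow> 'a \<Rightarrow> real) \<Rightarrow> real \<Rightarrow> real \<Rightarrow> real \<Rightarrow> (real \<Rightarrow> 'a) \<Rightarrow> real \<Rightarrow> bool" where
  "m_differentiable d k a b \<gamma> t \<longleftrightarrow>
     (\<exists>l. (m_quotient d k \<gamma> t \<longlongrightarrow> l) (at 0 within {s. t + s \<in> {a..b}}))"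

definition meas ::
  "('a \<Rightarrow> 'a \<Rightarrow> real) \<Rightarrow> real \<Rightarrow> real \<Rightarrow> real \<Rightarrow> (real \<Rightarrow> 'a) \<Rightarrow> real \<Rightarrow> real" where
  "meas d k a b \<gamma> t =
     (Lim (at 0 within {s. t + s \<in> {a..b}}) (m_quotient d k \<gamma> t)) powr k"

definition m_C1 ::
  "'a set \<Rightarrow> ('a \<Rightarrow> 'a \<Rightarrow> real) \<Rightarrow> real \<Rightarrow> real \<Rightarrow> real \<Rightarrow> (real \<Rightarrow> 'a) \<Rightarrow> bool" where
  "m_C1 M d k a b \<gamma> \<longleftrightarrow>
     continuous_map (top_of_set {a..b}) (Metric_space.mtopology M d) \<gamma> \<and>
     (\<forall>t\<in>{a..b}. m_differentiable d k a b \<gamma> t) \<and>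
     continuous_on {a..b} (meas d k a b \<gamma>)"


section \<open>Smooth maps between Euclidean spaces\<close>

text \<open>Only meant for open \<open>S\<close>. Since the domain is finite-dimensional, continuity of all
  iterated directional derivatives is the same as continuity of the iterated Frechet derivatives.\<close>

primrec Ck_on ::
  "nat \<Rightarrow> 'e::euclidean_space set \<Rightarrow> ('e \<Rightarrow> 'f::real_normed_vector) \<Rightarrow> bool" where
  "Ck_on 0 S f \<longleftrightarrow> continuous_on S f"
| "Ck_on (Suc n) S f \<longleftrightarrow>
     (\<forall>x\<in>S. f differentiable (at x)) \<and>
     (\<forall>v. Ck_on n S (\<lambda>x. frechet_derivative f (at x) v))"

definition smooth_on ::
  "'e::euclidean_space set \<Rightarrow> ('e \<Rightarrow> 'f::real_normed_vector) \<Rightarrow> bool" where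
  "smooth_on S f \<longleftrightarrow> (\<forall>n. Ck_on n S f)"


section \<open>Riemannian manifolds\<close>

type_synonym ('a, 'e) chart = "'a set \<times> ('a \<Rightarrow> 'e)"

definition transition ::
  "('a, 'e::euclidean_space) chart \<Rightarrow> ('a, 'e) chart \<Rightarrow> 'e \<Rightarrow> 'e" where
  "transition c c' = snd c' \<circ> inv_into (fst c) (snd c)"

locale smooth_manifold =
  fixes X :: "'a topology"
    and \<A> :: "('a, 'e::euclidean_space) chart set"
  assumes Hausdorff: "Hausdorff_space X"
    and second_countable: "second_countable X"
    and chart_domain: "(U, \<phi>) \<in> \<A> \<Longrightarrow> openin X U"
    and chart_image: "(U, \<phi>) \<in> \<A> \<Longrightarrow> open (\<phi> ` U)"
    and chart_homeo:
      "(U, \<phi>) \<in> \<A> \<Longrightarrow> homeomorphic_map (subtopology X U) (top_of_set (\<phi> ` U)) \<phi>"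
    and charts_cover: "(\<Union>(U, \<phi>)\<in>\<A>. U) = topspace X"
    and smooth_transition:
      "\<lbrakk>(U, \<phi>) \<in> \<A>; (V, \<psi>) \<in> \<A>\<rbrakk> \<Longrightarrow> smooth_on (\<phi> ` (U \<inter> V)) (transition (U, \<phi>) (V, \<psi>))"

text \<open>The metric is a smooth positive definite symmetric covariant 2-tensor field, given by its
  coordinate expressions: \<open>g (U, \<phi>) p v w\<close> is the inner product at \<open>p\<close> of the tangent vectors
  whose coordinates in the chart \<open>(U, \<phi>)\<close> are \<open>v\<close> and \<open>w\<close>. The last assumption is the tensor
  transformation law, that is, independence of the chart.\<close>

locale riemannian_manifold = smooth_manifold X \<A>
  for X :: "'a topology" and \<A> :: "('a, 'e::euclidean_space) chart set" +
  fixes g :: "('a, 'e) chart \<Rightarrow> 'a \<Rightarrow> 'e \<Rightarrow> 'e \<Rightarrow> real"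
  assumes metric_bilinear: "\<lbrakk>(U, \<phi>) \<in> \<A>; p \<in> U\<rbrakk> \<Longrightarrow> bilinear (g (U, \<phi>) p)"
    and metric_sym: "\<lbrakk>(U, \<phi>) \<in> \<A>; p \<in> U\<rbrakk> \<Longrightarrow> g (U, \<phi>) p v w = g (U, \<phi>) p w v"
    and metric_pos: "\<lbrakk>(U, \<phi>) \<in> \<A>; p \<in> U; v \<noteq> 0\<rbrakk> \<Longrightarrow> g (U, \<phi>) p v v > 0"
    and metric_smooth:
      "(U, \<phi>) \<in> \<A> \<Longrightarrow> smooth_on (\<phi> ` U) (\<lambda>x. g (U, \<phi>) (inv_into U \<phi> x) v w)"
    and metric_transform:
      "\<lbrakk>(U, \<phi>) \<in> \<A>; (V, \<psi>) \<in> \<A>; p \<in> U \<inter> V\<rbrakk> \<Longrightarrow>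
        g (U, \<phi>) p v w =
        g (V, \<psi>) p (frechet_derivative (transition (U, \<phi>) (V, \<psi>)) (at (\<phi> p)) v)
                   (frechet_derivative (transition (U, \<phi>) (V, \<psi>)) (at (\<phi> p)) w)"

definition C1_curve ::
  "'a topology \<Rightarrow> ('a, 'e::euclidean_space) chart set \<Rightarrow> (real \<Rightarrow> 'a) \<Rightarrow> real \<Rightarrow> real \<Rightarrow> bool" where
  "C1_curve X \<A> c \<alpha> \<beta> \<longleftrightarrow>
     continuous_map (top_of_set {\<alpha>..\<beta>}) X c \<and>
     (\<forall>(U, \<phi>)\<in>\<A>. \<exists>D. continuous_on ({\<alpha>..\<beta>} \<inter> c -` U) D \<and>
        (\<forall>t\<in>{\<alpha>..\<beta>} \<inter> c -` U. ((\<phi> \<circ> c) has_vector_derivative D t) (at t within {\<alpha>..\<beta>})))"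

text \<open>Unlike in the library's \<open>piecewise_C1_differentiable_on\<close>, the derivative has to extend
  continuously to the closed pieces, so that every curve has a finite length.\<close>

definition piecewise_C1_curve ::
  "'a topology \<Rightarrow> ('a, 'e::euclidean_space) chart set \<Rightarrow> (real \<Rightarrow> 'a) \<Rightarrow> real \<Rightarrow> real \<Rightarrow> bool" where
  "piecewise_C1_curve X \<A> c \<alpha> \<beta> \<longleftrightarrow>
     \<alpha> < \<beta> \<and>
     (\<exists>(n::nat) \<tau>. \<tau> 0 = \<alpha> \<and> \<tau> n = \<beta> \<and>
        (\<forall>i<n. \<tau> i < \<tau> (Suc i) \<and> C1_curve X \<A> c (\<tau> i) (\<tau> (Suc i))))"

text \<open>By the transformation law the speed does not depend on the chart that is selected.\<close>

definition chart_at :: "('a, 'e::euclidean_space) chart set \<Rightarrow> 'a \<Rightarrow> ('a, 'e) chart" where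
  "chart_at \<A> p = (SOME c. c \<in> \<A> \<and> p \<in> fst c)"

definition curve_length ::
  "('a, 'e::euclidean_space) chart set \<Rightarrow> (('a, 'e) chart \<Rightarrow> 'a \<Rightarrow> 'e \<Rightarrow> 'e \<Rightarrow> real) \<Rightarrow>
   (real \<Rightarrow> 'a) \<Rightarrow> real \<Rightarrow> real \<Rightarrow> real" where
  "curve_length \<A> g c \<alpha> \<beta> = integral {\<alpha>..\<beta>} (\<lambda>t.
     let ch = chart_at \<A> (c t);
         v = vector_derivative (snd ch \<circ> c) (at t within {\<alpha>..\<beta>})
     in sqrt (g ch (c t) v v))"

text \<open>Meaningful for connected manifolds, where the set of lengths is nonempty for all points
  of \<open>X\<close>. The value 0 off the carrier is needed because the library's \<open>Metric_space\<close>
  asks for nonnegativity on the whole type.\<close>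

definition riemannian_dist ::
  "'a topology \<Rightarrow> ('a, 'e::euclidean_space) chart set \<Rightarrow>
   (('a, 'e) chart \<Rightarrow> 'a \<Rightarrow> 'e \<Rightarrow> 'e \<Rightarrow> real) \<Rightarrow> 'a \<Rightarrow> 'a \<Rightarrow> real" where
  "riemannian_dist X \<A> g p q =
     (if p \<in> topspace X \<and> q \<in> topspace X
      then Inf {curve_length \<A> g c \<alpha> \<beta> | c \<alpha> \<beta>.
                  piecewise_C1_curve X \<A> c \<alpha> \<beta> \<and> c \<alpha> = p \<and> c \<beta> = q}
      else 0)"

end

theory Submission
  imports Defs "HOL-Real_Asymp.Real_Asymp"
begin

text \<open>Suppose \<open>k > 1\<close>. Near a point where \<open>meas\<close> is positive, the Riemannian distance is as close as
  we like, in ratio, to a Euclidean distance in a chart, so \<open>\<gamma>\<close> becomes a curve \<open>x\<close> in a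
  finite-dimensional inner product space with \<open>\<bar>x (t + s) - x t\<bar> \<approx> L \<bar>s\<bar> powr (1 / k)\<close> for small \<open>s\<close>.
  How small \<open>s\<close> has to be depends on \<open>t\<close>, but by Baire's theorem the estimate is uniform on some
  interval. By polarization, unit increments of \<open>x\<close> (at a small scale) that are \<open>M\<close> steps apart have
  inner product close to half the second difference of \<open>M powr (2 / k)\<close>, which tends to 0 because
  \<open>2 / k < 2\<close>. Arbitrarily many increments are thus nearly orthonormal, contradicting the finite
  dimension.\<close>

section \<open>Nearly isometric snowflakes in Euclidean spaces\<close>

text \<open>The bound \<open>2 / k < 2\<close> is sharp for this method: for exponent 2 the second
  difference is the constant 2, the value for parallel increments on a line, and only below 2 does
  it vanish at infinity. The contradiction needs just finitely many points in arithmetic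
  progression. Their number and the tolerated relative error \<open>\<eta>\<close> depend only on
  \<open>k\<close> and the dimension, so the distortion \<open>\<epsilon>\<close> of the chart can
  be fixed before the chart is known. The step \<open>h\<close> of the progression only multiplies
  squared distances by \<open>h powr (2 / k)\<close>, which a constant \<open>K\<close> absorbs;
  hence the progression may be as short as the uniform estimate demands. A second obstacle is the
  distance itself: it is an infimum over all curves, including those that leave the chart. Two
  concentric coordinate balls deal with it: coming in from the larger sphere costs at least as much
  as the distances to be estimated in the smaller ball.\<close>

lemma second_difference_powr_tendsto_0:
  fixes p :: real
  assumes "0 < p" "p < 2"
  shows "((\<lambda>x::real. (x + 1) powr p + (x - 1) powr p - 2 * x powr p) \<longlongrightarrow> 0) at_top"
proof -
  \<comment> \<open>The leading term is \<open>p * (p - 1) * x powr (p - 2)\<close>. The cases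
    settle the sign of its coefficient, which \<open>real_asymp\<close> must know; at
    \<open>p = 1\<close> it vanishes.\<close>
  consider "p = 1" | "p < 1" | "p > 1" by linarith
  then show ?thesis
  proof cases
    case 1 then show ?thesis by real_asymp
  next
    case 2
    then have "p * (p - 1) < 0" using assms by (simp add: mult_pos_neg)
    with 2 show ?thesis using assms by real_asymp
  next
    case 3
    then have "p * (p - 1) > 0" using assms by simp
    with 3 show ?thesis using assms by real_asymp
  qed
qed

text \<open>A strictly diagonally dominant Gram matrix is nonsingular: in a linear relation, the row
  belonging to the coefficient of largest modulus cannot sum to zero, since its \<open>n\<close>
  off-diagonal entries together stay below \<open>K / 4\<close>.\<close>

lemma nearly_orthogonal_family_less_DIM:
  fixes w :: "nat \<Rightarrow> 'e::euclidean_space" and G :: "'e \<Rightarrow> 'e \<Rightarrow> real"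
  assumes bil: "bilinear G" and "K > 0"
    and diag: "\<And>i. i \<le> n \<Longrightarrow> G (w i) (w i) \<ge> K / 2"
    and off: "\<And>i j. i \<le> n \<Longrightarrow> j \<le> n \<Longrightarrow> i \<noteq> j \<Longrightarrow> \<bar>G (w i) (w j)\<bar> \<le> K / (4 * (real n + 1))"
  shows "n < DIM('e)"
proof (rule ccontr)
  assume "\<not> n < DIM('e)"
  have small: "K / (4 * (real n + 1)) < K / 2"
    using \<open>K > 0\<close> by (intro divide_strict_left_mono) auto
  \<comment> \<open>\<open>dependent\<close> speaks of sets. Injectivity makes the family a set of
    \<open>n + 1\<close> vectors and lets the relation be indexed by \<open>{..n}\<close>.\<close>
  have inj: "inj_on w {..n}"
  proof (rule inj_onI, rule ccontr)
    fix i j assume "i \<in> {..n}" "j \<in> {..n}" "w i = w j" "i \<noteq> j"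
    then have "K / 2 \<le> G (w i) (w i)" "\<bar>G (w i) (w i)\<bar> \<le> K / (4 * (real n + 1))"
      using diag[of i] off[of i j] by auto
    then show False using small by linarith
  qed
  have "card (w ` {..n}) = n + 1"
    using card_image[OF inj] by simp
  with \<open>\<not> n < DIM('e)\<close> have "dependent (w ` {..n})"
    by (intro dependent_biggerset) auto
  then obtain u i0 where i0: "i0 \<le> n" "u (w i0) \<noteq> 0"
    and sum0: "(\<Sum>v\<in>w ` {..n}. u v *\<^sub>R v) = 0"
    by (auto simp: dependent_finite)
  define c where "c i = u (w i)" for i
  have sumc: "(\<Sum>i\<le>n. c i *\<^sub>R w i) = 0"
    using sum0 by (simp add: sum.reindex[OF inj] c_def)
  define A where "A = Max ((\<lambda>i. \<bar>c i\<bar>) ` {..n})"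
  have "A \<in> (\<lambda>i. \<bar>c i\<bar>) ` {..n}"
    unfolding A_def by (rule Max_in) auto
  then obtain i where i: "i \<le> n" "\<bar>c i\<bar> = A" by auto
  have le: "\<bar>c j\<bar> \<le> A" if "j \<le> n" for j
    unfolding A_def using that by (intro Max_ge) auto
  have "A > 0" using le[OF i0(1)] i0(2) by (auto simp: c_def)
  have lin: "linear (G (w i))" using bil by (simp add: bilinear_def)
  have "0 = G (w i) (\<Sum>j\<le>n. c j *\<^sub>R w j)"
    using sumc linear_0[OF lin] by simp
  also have "\<dots> = (\<Sum>j\<le>n. c j * G (w i) (w j))"
    by (simp add: linear_sum[OF lin] linear_scale[OF lin])
  also have "\<dots> = c i * G (w i) (w i) + (\<Sum>j\<in>{..n} - {i}. c j * G (w i) (w j))"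
    using i by (intro sum.remove) auto
  finally have "\<bar>c i * G (w i) (w i)\<bar> = \<bar>\<Sum>j\<in>{..n} - {i}. c j * G (w i) (w j)\<bar>"
    by linarith
  also have "\<dots> \<le> (\<Sum>j\<in>{..n} - {i}. \<bar>c j * G (w i) (w j)\<bar>)" by (rule sum_abs)
  also have "\<dots> \<le> (\<Sum>j\<in>{..n} - {i}. A * (K / (4 * (real n + 1))))"
    unfolding abs_mult
    by (intro sum_mono mult_mono le off) (use i \<open>A > 0\<close> in auto)
  also have "\<dots> = real n * (A * (K / (4 * (real n + 1))))"
    using i by simp
  also have "\<dots> < A * (K / 2)"
    using \<open>A > 0\<close> \<open>K > 0\<close> by (simp add: field_simps add_pos_nonneg)
  also have "\<dots> \<le> A * G (w i) (w i)"
    using diag[OF i(1)] \<open>A > 0\<close> by simp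
  also have "\<dots> \<le> \<bar>c i * G (w i) (w i)\<bar>"
    using i by (simp add: abs_mult mult_left_mono flip: i(2))
  finally show False by simp
qed

text \<open>Only mutual squared distances of the four end points occur on the right, so distance
  estimates alone control the product of two increments. Along a progression the right side is a
  second difference.\<close>

lemma bilinear_polarization:
  fixes G :: "'e::real_vector \<Rightarrow> 'e \<Rightarrow> real"
  assumes bil: "bilinear G" and sym: "\<And>v w. G v w = G w v"
  shows "2 * G (a - b) (c - d) =
    G (a - d) (a - d) + G (b - c) (b - c) - G (a - c) (a - c) - G (b - d) (b - d)"
  using sym[of b a] sym[of c a] sym[of d a] sym[of c b] sym[of d b] sym[of d c]
  by (simp add: bilinear_lsub[OF bil] bilinear_rsub[OF bil])

text \<open>Unit increments sampled every \<open>m\<close> steps form a nearly orthogonal family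
  with one vector too many. \<open>\<eta>\<close> and \<open>N\<close> depend only on
  \<open>p\<close> and the dimension and come before \<open>G\<close>, \<open>K\<close> and
  \<open>y\<close>, so the form and the scale can be selected later.\<close>

lemma no_near_snowflake:
  fixes p :: real
  assumes p: "0 < p" "p < 2"
  obtains \<eta> :: real and N :: nat where "0 < \<eta>" "\<eta> < 1"
    "\<And>(G :: 'e::euclidean_space \<Rightarrow> 'e \<Rightarrow> real) K y.
      \<lbrakk>bilinear G; \<And>v w. G v w = G w v; K > 0;
       \<And>i j. i \<le> N \<Longrightarrow> j \<le> N \<Longrightarrow>
         \<bar>G (y i - y j) (y i - y j) - K * \<bar>real i - real j\<bar> powr p\<bar>
           \<le> \<eta> * (K * \<bar>real i - real j\<bar> powr p)\<rbrakk> \<Longrightarrow> False"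
proof -
  define n where "n = DIM('e)"
  have "\<forall>\<^sub>F x in at_top. \<bar>(x + 1) powr p + (x - 1) powr p - 2 * x powr p\<bar> < 1 / (4 * (real n + 1))"
    using order_tendstoD(2)[OF tendsto_rabs_zero[OF second_difference_powr_tendsto_0[OF p]], of "1 / (4 * (real n + 1))"]
    by simp
  then obtain m0 where m0: "\<And>x. x \<ge> m0 \<Longrightarrow>
      \<bar>(x + 1) powr p + (x - 1) powr p - 2 * x powr p\<bar> < 1 / (4 * (real n + 1))"
    by (auto simp: eventually_at_top_linorder)
  \<comment> \<open>Increments at distinct multiples of \<open>m\<close> are far enough apart for
    the second difference to be small. \<open>m \<ge> 1\<close> keeps \<open>M - 1\<close>
    nonnegative when the absolute values are resolved.\<close>
  define m where "m = nat \<lceil>m0\<rceil> + 1"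
  have m: "real m \<ge> m0" "m \<ge> 1" unfolding m_def by linarith+
  define N where "N = n * m + 1"
  define P where "P = real N powr p"
  have P1: "P \<ge> 1" unfolding P_def N_def using p by (intro ge_one_powr_ge_zero) auto
  \<comment> \<open>\<open>P\<close> bounds every power that occurs, so each squared distance is off
    by at most \<open>\<eta> * K * P\<close>. Polarization adds four such errors;
    \<open>\<eta>\<close> makes their sum equal to the bound \<open>K / (4 * (real n + 1))\<close>
    for the second difference, and halving \<open>2 * G\<close> gives the required off-diagonal
    bound.\<close>
  define \<eta> where "\<eta> = 1 / (16 * (real n + 1) * P)"
  have \<eta>: "0 < \<eta>" "\<eta> \<le> 1/2" "4 * (\<eta> * P) = 1 / (4 * (real n + 1))"
  proof -
    show "0 < \<eta>" using P1 by (simp add: \<eta>_def)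
    have "2 * 1 \<le> 16 * (real n + 1) * P" using P1 by (intro mult_mono) auto
    then show "\<eta> \<le> 1/2" using P1 unfolding \<eta>_def by (simp add: field_simps)
    show "4 * (\<eta> * P) = 1 / (4 * (real n + 1))" using P1 unfolding \<eta>_def by (simp add: divide_simps)
  qed
  show thesis
  proof (rule that[of \<eta> N])
    show "0 < \<eta>" "\<eta> < 1" using \<eta> by auto
    fix G :: "'e \<Rightarrow> 'e \<Rightarrow> real" and K :: real and y :: "nat \<Rightarrow> 'e"
    assume bil: "bilinear G" and sym: "\<And>v w. G v w = G w v" and K: "K > 0"
      and near: "\<And>i j. i \<le> N \<Longrightarrow> j \<le> N \<Longrightarrow>
         \<bar>G (y i - y j) (y i - y j) - K * \<bar>real i - real j\<bar> powr p\<bar>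
           \<le> \<eta> * (K * \<bar>real i - real j\<bar> powr p)"
    define q where "q i j = G (y i - y j) (y i - y j)" for i j
    have near': "\<bar>q i j - K * \<bar>real i - real j\<bar> powr p\<bar> \<le> \<eta> * K * P" if "i \<le> N" "j \<le> N" for i j
    proof -
      have "\<bar>real i - real j\<bar> powr p \<le> P"
        unfolding P_def using that p by (intro powr_mono2) auto
      then have "\<eta> * (K * \<bar>real i - real j\<bar> powr p) \<le> \<eta> * (K * P)"
        using \<eta>(1) K by simp
      then show ?thesis using near[OF that] unfolding q_def by (simp add: mult.assoc)
    qed
    define w where "w j = y (j * m + 1) - y (j * m)" for j
    have bd: "j * m + 1 \<le> N" "j * m \<le> N" if "j \<le> n" for j
      using mult_le_mono1[OF that, of m] unfolding N_def by linarith+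
    have off: "\<bar>G (w i) (w j)\<bar> \<le> K / (4 * (real n + 1))" if "i \<le> n" "j < i" for i j
    proof -
      define M where "M = real i * real m - real j * real m"
      have "j * m + m \<le> i * m" using that mult_le_mono1[of "Suc j" i m] by simp
      then have "real (j * m + m) \<le> real (i * m)" by (simp only: of_nat_le_iff)
      then have Mm: "M \<ge> real m" by (simp add: M_def)
      have bi: "i * m + 1 \<le> N" "i * m \<le> N" "j * m + 1 \<le> N" "j * m \<le> N"
        using bd[of i] bd[of j] that by auto
      have e: "\<bar>real (i * m + 1) - real (j * m)\<bar> = M + 1"
        "\<bar>real (i * m) - real (j * m + 1)\<bar> = M - 1"
        "\<bar>real (i * m + 1) - real (j * m + 1)\<bar> = M"
        "\<bar>real (i * m) - real (j * m)\<bar> = M"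
        using Mm m(2) by (auto simp: M_def)
      have "2 * G (w i) (w j) = q (i * m + 1) (j * m) + q (i * m) (j * m + 1)
          - q (i * m + 1) (j * m + 1) - q (i * m) (j * m)"
        unfolding w_def q_def by (rule bilinear_polarization[OF bil sym])
      moreover note near'[OF bi(1) bi(4), unfolded e] near'[OF bi(2) bi(3), unfolded e]
        near'[OF bi(1) bi(3), unfolded e] near'[OF bi(2) bi(4), unfolded e]
      ultimately have "\<bar>2 * G (w i) (w j) - K * ((M + 1) powr p + (M - 1) powr p - 2 * M powr p)\<bar>
          \<le> 4 * (\<eta> * K * P)"
        unfolding right_diff_distrib distrib_left by linarith
      moreover have "\<bar>K * ((M + 1) powr p + (M - 1) powr p - 2 * M powr p)\<bar> \<le> K * (1 / (4 * (real n + 1)))"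
        using m0[of M] Mm m(1) K by (simp add: abs_mult mult_left_mono del: times_divide_eq_right)
      moreover have "4 * (\<eta> * K * P) = K * (1 / (4 * (real n + 1)))"
        using \<eta>(3) by (simp add: mult_ac)
      ultimately have "\<bar>2 * G (w i) (w j)\<bar> \<le> 2 * (K * (1 / (4 * (real n + 1))))"
        by linarith
      then show ?thesis by (simp add: abs_mult)
    qed
    have "n < DIM('e)"
    proof (rule nearly_orthogonal_family_less_DIM[OF bil K])
      fix i assume "i \<le> n"
      then have "\<bar>G (w i) (w i) - K\<bar> \<le> \<eta> * K"
        using near[of "i * m + 1" "i * m"] bd[of i] by (simp add: w_def)
      moreover have "\<eta> * K \<le> 1 / 2 * K" using \<eta>(2) K by (intro mult_right_mono) auto
      ultimately show "K / 2 \<le> G (w i) (w i)" by linarith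
    next
      fix i j assume "i \<le> n" "j \<le> n" "i \<noteq> j"
      then show "\<bar>G (w i) (w j)\<bar> \<le> K / (4 * (real n + 1))"
        using off[of i j] off[of j i] sym[of "w i" "w j"] by (cases "j < i") auto
    qed
    then show False by (simp add: n_def)
  qed
qed

text \<open>The radius \<open>\<delta>\<close> may depend on \<open>t\<close>. The times for which
  \<open>1 / Suc n\<close> serves form a set \<open>E n\<close>; once some \<open>E n\<close>
  contains a ball, a short progression inside it satisfies a uniform estimate, with
  \<open>K * h powr p\<close> in place of \<open>K\<close>.\<close>

lemma no_pointwise_near_snowflake:
  fixes p :: real
  assumes p: "0 < p" "p < 2"
  obtains \<eta> :: real where "0 < \<eta>" "\<eta> < 1"
    "\<And>(G :: 'e::euclidean_space \<Rightarrow> 'e \<Rightarrow> real) K x u v.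
      \<lbrakk>bilinear G; \<And>v w. G v w = G w v; K > 0; u < v; continuous_on {u..v} x;
       \<And>t. t \<in> {u..v} \<Longrightarrow> \<exists>\<delta>>0. \<forall>t'\<in>{u..v}. \<bar>t' - t\<bar> < \<delta> \<longrightarrow>
         \<bar>G (x t' - x t) (x t' - x t) - K * \<bar>t' - t\<bar> powr p\<bar> \<le> \<eta> * (K * \<bar>t' - t\<bar> powr p)\<rbrakk>
      \<Longrightarrow> False"
proof -
  obtain \<eta> :: real and N :: nat where \<eta>: "0 < \<eta>" "\<eta> < 1"
    and core: "\<And>(G :: 'e::euclidean_space \<Rightarrow> 'e \<Rightarrow> real) K y.
      \<lbrakk>bilinear G; \<And>v w. G v w = G w v; K > 0;
       \<And>i j. i \<le> N \<Longrightarrow> j \<le> N \<Longrightarrow>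
         \<bar>G (y i - y j) (y i - y j) - K * \<bar>real i - real j\<bar> powr p\<bar>
           \<le> \<eta> * (K * \<bar>real i - real j\<bar> powr p)\<rbrakk> \<Longrightarrow> False"
    using no_near_snowflake[OF p] by metis
  show thesis
  proof (rule that[OF \<eta>])
    fix G :: "'e \<Rightarrow> 'e \<Rightarrow> real" and K u v :: real and x
    assume bil: "bilinear G" and sym: "\<And>v w. G v w = G w v" and K: "K > 0" and "u < v"
      and cont: "continuous_on {u..v} x"
      and local: "\<And>t. t \<in> {u..v} \<Longrightarrow> \<exists>\<delta>>0. \<forall>t'\<in>{u..v}. \<bar>t' - t\<bar> < \<delta> \<longrightarrow>
         \<bar>G (x t' - x t) (x t' - x t) - K * \<bar>t' - t\<bar> powr p\<bar> \<le> \<eta> * (K * \<bar>t' - t\<bar> powr p)"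
    define R where "R t t' \<longleftrightarrow>
      \<bar>G (x t' - x t) (x t' - x t) - K * \<bar>t' - t\<bar> powr p\<bar> \<le> \<eta> * (K * \<bar>t' - t\<bar> powr p)" for t t'
    define E where "E n = {t \<in> {u..v}. \<forall>t'\<in>{u..v}. \<bar>t' - t\<bar> < 1 / real (Suc n) \<longrightarrow> R t t'}" for n
    have bb: "bounded_bilinear G" using bil by (simp add: bilinear_conv_bounded_bilinear)
    have closedE: "closed (E n)" for n
    proof -
      have "closed {t \<in> {u..v}. \<bar>t' - t\<bar> < 1 / real (Suc n) \<longrightarrow> R t t'}" for t'
      proof -
        \<comment> \<open>For fixed \<open>t'\<close> the implication is a union of two closed
          conditions: the strict bound in its premise has a closed negation, and \<open>R\<close> is
          closed by continuity of \<open>x\<close>.\<close>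
        have "closed {t \<in> {u..v}. 1 / real (Suc n) \<le> \<bar>t' - t\<bar>}"
          by (intro continuous_on_closed_Collect_le continuous_intros) auto
        moreover have "closed {t \<in> {u..v}. R t t'}"
          unfolding R_def
          by (intro continuous_on_closed_Collect_le continuous_intros
              bounded_bilinear.continuous_on[OF bb] cont continuous_on_powr') (use p in auto)
        ultimately have "closed ({t \<in> {u..v}. 1 / real (Suc n) \<le> \<bar>t' - t\<bar>} \<union> {t \<in> {u..v}. R t t'})"
          by (rule closed_Un)
        also have "\<dots> = {t \<in> {u..v}. \<bar>t' - t\<bar> < 1 / real (Suc n) \<longrightarrow> R t t'}"
          by (auto simp: not_le)
        finally show ?thesis .
      qed
      then have "closed (\<Inter>t'\<in>{u..v}. {t \<in> {u..v}. \<bar>t' - t\<bar> < 1 / real (Suc n) \<longrightarrow> R t t'})"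
        by blast
      also have "\<dots> = E n" using \<open>u < v\<close> unfolding E_def by fastforce
      finally show ?thesis .
    qed
    have "(\<Union>n. E n) = {u..v}"
    proof safe
      fix t assume t: "t \<in> {u..v}"
      then obtain \<delta> where \<delta>: "\<delta> > 0" "\<forall>t'\<in>{u..v}. \<bar>t' - t\<bar> < \<delta> \<longrightarrow> R t t'"
        using local unfolding R_def by meson
      obtain n where "1 / real (Suc n) < \<delta>"
        using reals_Archimedean[OF \<delta>(1)] by (auto simp: inverse_eq_divide)
      then have "t \<in> E n" using t \<delta>(2) unfolding E_def by (auto simp del: of_nat_Suc)
      then show "t \<in> (\<Union>n. E n)" by blast
    qed (auto simp: E_def)
    then have "interior (\<Union>n. E n) \<noteq> {}" using \<open>u < v\<close> by simp
    then obtain n where "interior (E n) \<noteq> {}"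
      using Baire_category_alt[of "euclidean :: real topology" "range E"] closedE
        completely_metrizable_space_euclidean by auto
    then obtain t0 e where e: "e > 0" "ball t0 e \<subseteq> E n"
      by (meson equals0I mem_interior)
    define e' where "e' = min e (1 / real (Suc n))"
    have e': "e' > 0" "e' \<le> e" "e' \<le> 1 / real (Suc n)" using e by (auto simp: e'_def)
    \<comment> \<open>All points \<open>t0 + h * i\<close> with \<open>i \<le> N\<close> lie in the
      ball inside \<open>E n\<close>, and any two of them are closer than \<open>1 / Suc n\<close>,
      as the condition in \<open>E n\<close> asks.\<close>
    define h where "h = e' / (2 * (real N + 1))"
    have "h > 0" "h * (2 * (real N + 1)) = e'"
      using e' by (simp_all add: h_def)
    moreover from this have "h * real N < h * (2 * (real N + 1))"
      by (intro mult_strict_left_mono) auto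
    ultimately have h: "h > 0" "h * real N < e'" by auto
    have hi: "h * real i < e'" if "i \<le> N" for i
    proof -
      have "h * real i \<le> h * real N" using that h by (intro mult_left_mono) auto
      then show ?thesis using h(2) by linarith
    qed
    define y where "y i = x (t0 + h * real i)" for i
    have in_E: "t0 + h * real i \<in> E n" if "i \<le> N" for i
      using hi[OF that] h(1) e' by (intro subsetD[OF e(2)]) (simp add: dist_real_def)
    show False
    proof (rule core[OF bil sym, of "K * h powr p" y])
      show "0 < K * h powr p" using K h by simp
      fix i j assume ij: "i \<le> N" "j \<le> N"
      have eq: "\<bar>(t0 + h * real i) - (t0 + h * real j)\<bar> = h * \<bar>real i - real j\<bar>"
        using h by (simp add: abs_mult flip: right_diff_distrib)
      have "\<bar>real i - real j\<bar> \<le> real N" using ij by auto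
      then have "h * \<bar>real i - real j\<bar> \<le> h * real N"
        using h by (intro mult_left_mono) auto
      then have "h * \<bar>real i - real j\<bar> < e'" using h(2) by linarith
      then have "R (t0 + h * real j) (t0 + h * real i)"
        using in_E[OF ij(1)] in_E[OF ij(2)] e'(3) unfolding E_def eq[symmetric] by fastforce
      then show "\<bar>G (y i - y j) (y i - y j) - K * h powr p * \<bar>real i - real j\<bar> powr p\<bar>
           \<le> \<eta> * (K * h powr p * \<bar>real i - real j\<bar> powr p)"
        using h unfolding R_def eq y_def by (simp add: powr_mult mult.assoc)
    qed
  qed
qed

section \<open>Charts and curves\<close>

lemma bilinear_Basis_expansion:
  fixes B :: "'e::euclidean_space \<Rightarrow> 'e \<Rightarrow> real"
  assumes "bilinear B"
  shows "B v w = (\<Sum>i\<in>Basis. \<Sum>j\<in>Basis. (v \<bullet> i) * (w \<bullet> j) * B i j)"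
proof -
  have "B v w = B (\<Sum>i\<in>Basis. (v \<bullet> i) *\<^sub>R i) (\<Sum>j\<in>Basis. (w \<bullet> j) *\<^sub>R j)"
    by (simp add: euclidean_representation)
  also have "\<dots> = (\<Sum>i\<in>Basis. \<Sum>j\<in>Basis. B ((v \<bullet> i) *\<^sub>R i) ((w \<bullet> j) *\<^sub>R j))"
    by (subst bilinear_sum[OF assms]) (simp add: sum.cartesian_product)
  finally show ?thesis
    by (simp add: bilinear_lmul[OF assms] bilinear_rmul[OF assms] mult_ac)
qed

text \<open>The metric frozen at one point of a chart has this form. It need not be the inner
  product of the type: balls and topology refer to the standard norm, lengths to
  \<open>G\<close>.\<close>

locale inner_form =
  fixes G :: "'e::euclidean_space \<Rightarrow> 'e \<Rightarrow> real"
  assumes bilinear: "bilinear G" and sym: "G v w = G w v" and pos: "v \<noteq> 0 \<Longrightarrow> G v v > 0"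
begin

lemma nonneg: "G v v \<ge> 0"
  using pos[of v] bilinear_lzero[OF bilinear] by (cases "v = 0") auto

lemma scale: "G (r *\<^sub>R v) (r *\<^sub>R v) = r\<^sup>2 * G v v"
  by (simp add: bilinear_lmul[OF bilinear] bilinear_rmul[OF bilinear] power2_eq_square)

lemma minus_commute: "G (v - w) (v - w) = G (w - v) (w - v)"
  using scale[of "-1" "v - w"] by simp

lemma Cauchy_Schwarz: "G v w \<le> sqrt (G v v) * sqrt (G w w)"
proof (cases "w = 0")
  case True
  then show ?thesis by (simp add: bilinear_rzero[OF bilinear])
next
  case False
  then have w: "G w w > 0" by (rule pos)
  \<comment> \<open>The vector is \<open>G w w\<close> times the component of \<open>v\<close> that
    is \<open>G\<close>-orthogonal to \<open>w\<close>.\<close>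
  have "0 \<le> G (G w w *\<^sub>R v - G v w *\<^sub>R w) (G w w *\<^sub>R v - G v w *\<^sub>R w)" by (rule nonneg)
  also have "\<dots> = G w w * (G w w * G v v - (G v w)\<^sup>2)"
    by (simp add: bilinear_lsub[OF bilinear] bilinear_rsub[OF bilinear] bilinear_lmul[OF bilinear]
        bilinear_rmul[OF bilinear] sym[of w v] algebra_simps power2_eq_square)
  finally have "(G v w)\<^sup>2 \<le> G v v * G w w"
    using w by (simp add: zero_le_mult_iff mult.commute)
  then have "\<bar>G v w\<bar> \<le> sqrt (G v v * G w w)"
    by (metis real_sqrt_abs real_sqrt_le_mono)
  then show ?thesis by (simp add: real_sqrt_mult)
qed

text \<open>\<open>m\<close> comes from the minimum of \<open>G v v\<close> on the compact unit
  sphere, \<open>M\<close> from the boundedness of bilinear forms. They translate between coordinate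
  balls and lengths in \<open>G\<close>.\<close>

lemma norm_equivalent:
  obtains m M where "m > 0" "M > 0" "\<And>v. m * norm v \<le> sqrt (G v v)" "\<And>v. sqrt (G v v) \<le> M * norm v"
proof -
  have bb: "bounded_bilinear G" using bilinear by (simp add: bilinear_conv_bounded_bilinear)
  have "sphere (0::'e) 1 \<noteq> {}" by simp
  moreover have "continuous_on (sphere 0 1) (\<lambda>v. G v v)"
    by (intro bounded_bilinear.continuous_on[OF bb] continuous_intros)
  ultimately obtain v0 where v0: "v0 \<in> sphere 0 1" "\<And>v. v \<in> sphere 0 1 \<Longrightarrow> G v0 v0 \<le> G v v"
    using continuous_attains_inf[of "sphere (0::'e) 1" "\<lambda>v. G v v"] by auto
  obtain K where K: "K > 0" "\<And>v w. norm (G v w) \<le> norm v * norm w * K"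
    using bounded_bilinear.pos_bounded[OF bb] by blast
  show thesis
  proof (rule that)
    have "v0 \<noteq> 0" using v0(1) by auto
    then show "sqrt (G v0 v0) > 0" using pos by simp
    show "sqrt K > 0" using K by simp
    fix v :: 'e
    show "sqrt (G v0 v0) * norm v \<le> sqrt (G v v)"
    proof (cases "v = 0")
      case True
      then show ?thesis by (simp add: nonneg)
    next
      case False
      then have "G v0 v0 \<le> G ((1 / norm v) *\<^sub>R v) ((1 / norm v) *\<^sub>R v)"
        by (intro v0(2)) simp
      also have "\<dots> = (1 / norm v)\<^sup>2 * G v v" by (rule scale)
      finally have "G v0 v0 * (norm v)\<^sup>2 \<le> G v v"
        using False by (simp add: field_simps power_divide)
      then have "sqrt (G v0 v0 * (norm v)\<^sup>2) \<le> sqrt (G v v)" by (rule real_sqrt_le_mono)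
      then show ?thesis by (simp add: real_sqrt_mult)
    qed
    have "G v v \<le> K * (norm v)\<^sup>2"
      using K(2)[of v v] by (simp add: power2_eq_square mult_ac)
    then have "sqrt (G v v) \<le> sqrt (K * (norm v)\<^sup>2)" by (rule real_sqrt_le_mono)
    then show "sqrt (G v v) \<le> sqrt K * norm v" by (simp add: real_sqrt_mult)
  qed
qed

end

section \<open>Charts, changes of chart, and curves that leave a coordinate ball\<close>

context smooth_manifold
begin

lemma chart_domain_subset: "(U, \<phi>) \<in> \<A> \<Longrightarrow> U \<subseteq> topspace X"
  using chart_domain openin_subset by blast

lemma chart_inj: "(U, \<phi>) \<in> \<A> \<Longrightarrow> inj_on \<phi> U"
  using homeomorphic_imp_injective_map[OF chart_homeo] chart_domain_subset
  by (metis topspace_subtopology_subset)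

lemma chart_continuous: "(U, \<phi>) \<in> \<A> \<Longrightarrow> continuous_map (subtopology X U) euclidean \<phi>"
  using homeomorphic_imp_continuous_map[OF chart_homeo] continuous_map_in_subtopology by blast

lemma chart_inverse_continuous:
  assumes "(U, \<phi>) \<in> \<A>"
  shows "continuous_map (top_of_set (\<phi> ` U)) X (inv_into U \<phi>)"
proof -
  obtain f where f: "homeomorphic_maps (subtopology X U) (top_of_set (\<phi> ` U)) \<phi> f"
    using chart_homeo[OF assms] homeomorphic_map_maps by blast
  have U: "topspace (subtopology X U) = U"
    using chart_domain_subset[OF assms] by (rule topspace_subtopology_subset)
  have "continuous_map (top_of_set (\<phi> ` U)) X f"
    using f unfolding homeomorphic_maps_def continuous_map_in_subtopology by blast
  then show ?thesis
  proof (rule continuous_map_eq)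
    fix x assume "x \<in> topspace (top_of_set (\<phi> ` U))"
    then obtain p where p: "p \<in> U" "x = \<phi> p" by auto
    then have "f x = p" using f U unfolding homeomorphic_maps_def by auto
    then show "f x = inv_into U \<phi> x" using p chart_inj[OF assms] by simp
  qed
qed

lemma openin_chart_preimage:
  assumes "(U, \<phi>) \<in> \<A>" "open W"
  shows "openin X {p \<in> U. \<phi> p \<in> W}"
proof -
  have "openin (subtopology X U) {p \<in> topspace (subtopology X U). \<phi> p \<in> W}"
    using openin_continuous_map_preimage[OF chart_continuous[OF assms(1)]] assms(2) by simp
  then show ?thesis
    using chart_domain[OF assms(1)] chart_domain_subset[OF assms(1)] openin_trans_full
    by (metis topspace_subtopology_subset)
qed

text \<open>Compact sets in a Hausdorff space are closed, so the preimage is closed in all of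
  \<open>X\<close> and not merely in \<open>U\<close>. This keeps a curve from leaving
  \<open>U\<close> out of a coordinate ball without meeting its sphere.\<close>

lemma closedin_chart_preimage_compact:
  assumes "(U, \<phi>) \<in> \<A>" "compact K" "K \<subseteq> \<phi> ` U"
  shows "closedin X {p \<in> U. \<phi> p \<in> K}"
proof -
  have "compactin (top_of_set (\<phi> ` U)) K"
    using assms(2,3) by (simp add: compactin_subtopology)
  then have "compactin X (inv_into U \<phi> ` K)"
    using image_compactin chart_inverse_continuous[OF assms(1)] by blast
  moreover have "inv_into U \<phi> ` K = {p \<in> U. \<phi> p \<in> K}"
  proof
    show "inv_into U \<phi> ` K \<subseteq> {p \<in> U. \<phi> p \<in> K}"
      using assms(3) by (auto simp: inv_into_into f_inv_into_f subset_iff)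
    show "{p \<in> U. \<phi> p \<in> K} \<subseteq> inv_into U \<phi> ` K"
      using chart_inj[OF assms(1)] by (force simp: image_iff)
  qed
  ultimately show ?thesis using compactin_imp_closedin[OF Hausdorff] by simp
qed

lemma ex_chart:
  assumes "p \<in> topspace X"
  obtains U \<phi> where "(U, \<phi>) \<in> \<A>" "p \<in> U"
  using assms charts_cover by blast

lemma chart_at_valid:
  assumes "p \<in> topspace X"
  shows "chart_at \<A> p \<in> \<A>" "p \<in> fst (chart_at \<A> p)"
proof -
  obtain U \<phi> where "(U, \<phi>) \<in> \<A>" "p \<in> U" using ex_chart[OF assms] .
  then have "\<exists>c. c \<in> \<A> \<and> p \<in> fst c" by force
  from someI_ex[OF this] show "chart_at \<A> p \<in> \<A>" "p \<in> fst (chart_at \<A> p)"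
    unfolding chart_at_def by auto
qed

lemma transition_has_derivative:
  assumes "(U, \<phi>) \<in> \<A>" "(V, \<psi>) \<in> \<A>" "p \<in> U \<inter> V"
  shows "(transition (U, \<phi>) (V, \<psi>) has_derivative
    frechet_derivative (transition (U, \<phi>) (V, \<psi>)) (at (\<phi> p))) (at (\<phi> p))"
proof -
  have "Ck_on (Suc 0) (\<phi> ` (U \<inter> V)) (transition (U, \<phi>) (V, \<psi>))"
    using smooth_transition[OF assms(1,2)] unfolding smooth_on_def by blast
  then show ?thesis using assms(3) by (simp add: frechet_derivative_works)
qed

lemma transition_derivative_continuous:
  assumes "(U, \<phi>) \<in> \<A>" "(V, \<psi>) \<in> \<A>"
  shows "continuous_on (\<phi> ` (U \<inter> V))
    (\<lambda>x. frechet_derivative (transition (U, \<phi>) (V, \<psi>)) (at x) v)"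
proof -
  have "Ck_on (Suc 0) (\<phi> ` (U \<inter> V)) (transition (U, \<phi>) (V, \<psi>))"
    using smooth_transition[OF assms(1,2)] unfolding smooth_on_def by blast
  then show ?thesis by simp
qed

lemma transition_chart:
  assumes "(U, \<phi>) \<in> \<A>" "p \<in> U"
  shows "transition (U, \<phi>) (V, \<psi>) (\<phi> p) = \<psi> p"
  using assms chart_inj[OF assms(1)] by (simp add: transition_def)

lemma curve_preimage_ball:
  fixes c :: "'b::metric_space \<Rightarrow> 'a"
  assumes "continuous_map (top_of_set S) X c" "openin X U" "t \<in> S" "c t \<in> U"
  obtains \<delta> where "\<delta> > 0" "\<And>s. s \<in> S \<Longrightarrow> dist s t < \<delta> \<Longrightarrow> c s \<in> U"
proof -
  have "openin (top_of_set S) {s \<in> S. c s \<in> U}"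
    using openin_continuous_map_preimage[OF assms(1,2)] by simp
  then show thesis using that assms(3,4)
    by (auto simp: openin_euclidean_subtopology_iff)
qed

text \<open>As long as \<open>c\<close> is in \<open>U\<close>, \<open>\<psi> \<circ> c\<close> is
  the transition map composed with \<open>\<phi> \<circ> c\<close>, and continuity keeps
  \<open>c\<close> there near \<open>t\<close>. The chain rule does the rest.\<close>

lemma curve_derivative_change_chart:
  assumes c: "continuous_map (top_of_set S) X c" and t: "t \<in> S" "c t \<in> U \<inter> V"
    and ch: "(U, \<phi>) \<in> \<A>" "(V, \<psi>) \<in> \<A>"
    and v: "((\<phi> \<circ> c) has_vector_derivative v) (at t within S)"
  shows "((\<psi> \<circ> c) has_vector_derivative
    frechet_derivative (transition (U, \<phi>) (V, \<psi>)) (at (\<phi> (c t))) v) (at t within S)"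
proof -
  obtain \<delta> where \<delta>: "\<delta> > 0" "\<And>s. s \<in> S \<Longrightarrow> dist s t < \<delta> \<Longrightarrow> c s \<in> U"
    using curve_preimage_ball[OF c chart_domain[OF ch(1)] t(1)] t(2) by blast
  have "((transition (U, \<phi>) (V, \<psi>) \<circ> (\<phi> \<circ> c)) has_vector_derivative
    frechet_derivative (transition (U, \<phi>) (V, \<psi>)) (at (\<phi> (c t))) v) (at t within S)"
    using transition_has_derivative[OF ch t(2)]
    by (intro vector_derivative_diff_chain_within[OF v]) (simp add: has_derivative_at_withinI)
  then show ?thesis
    by (rule has_vector_derivative_transform_within[OF _ \<delta>(1) t(1)])
      (use \<delta>(2) transition_chart[OF ch(1)] in auto)
qed

text \<open>\<open>T\<close> is the last time outside the open ball. Before it the curve may have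
  left \<open>U\<close> altogether, so only the stretch \<open>{T..\<beta>}\<close> can be treated
  in the chart; that is enough to bound a length from below.\<close>

lemma last_entry_time:
  fixes \<alpha> \<beta> :: real
  assumes ch: "(U, \<phi>) \<in> \<A>" and sub: "cball x0 \<rho> \<subseteq> \<phi> ` U"
    and c: "continuous_map (top_of_set {\<alpha>..\<beta>}) X c" and "\<alpha> \<le> \<beta>"
    and end_in: "c \<beta> \<in> U" "\<phi> (c \<beta>) \<in> ball x0 \<rho>"
  shows "(\<forall>t\<in>{\<alpha>..\<beta>}. c t \<in> U \<and> \<phi> (c t) \<in> ball x0 \<rho>) \<or>
    (\<exists>T\<in>{\<alpha>..\<beta>}. (\<forall>t\<in>{T..\<beta>}. c t \<in> U \<and> \<phi> (c t) \<in> cball x0 \<rho>) \<and> dist x0 (\<phi> (c T)) = \<rho>)"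
proof (rule disjCI)
  assume not_all: "\<not> (\<exists>T\<in>{\<alpha>..\<beta>}. (\<forall>t\<in>{T..\<beta>}. c t \<in> U \<and> \<phi> (c t) \<in> cball x0 \<rho>)
    \<and> dist x0 (\<phi> (c T)) = \<rho>)"
  define Z where "Z = {t \<in> {\<alpha>..\<beta>}. \<not> (c t \<in> U \<and> \<phi> (c t) \<in> ball x0 \<rho>)}"
  have "Z = {}"
  proof (rule ccontr)
    assume "Z \<noteq> {}"
    have "openin (top_of_set {\<alpha>..\<beta>}) {t \<in> {\<alpha>..\<beta>}. c t \<in> {p \<in> U. \<phi> p \<in> ball x0 \<rho>}}"
      using openin_continuous_map_preimage[OF c openin_chart_preimage[OF ch open_ball]] by simp
    from closedin_diff[OF closedin_topspace this]
    have "closedin (top_of_set {\<alpha>..\<beta>})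
      (topspace (top_of_set {\<alpha>..\<beta>}) - {t \<in> {\<alpha>..\<beta>}. c t \<in> {p \<in> U. \<phi> p \<in> ball x0 \<rho>}})" .
    also have "topspace (top_of_set {\<alpha>..\<beta>}) - {t \<in> {\<alpha>..\<beta>}. c t \<in> {p \<in> U. \<phi> p \<in> ball x0 \<rho>}} = Z"
      by (auto simp: Z_def)
    finally have "closed Z" by (rule closedin_closed_trans) simp
    define T where "T = Sup Z"
    have bdd: "bdd_above Z" by (rule bdd_aboveI[of _ \<beta>]) (auto simp: Z_def)
    have "T \<in> Z" unfolding T_def
      by (rule closed_contains_Sup[OF \<open>Z \<noteq> {}\<close> bdd \<open>closed Z\<close>])
    then have "T \<in> {\<alpha>..\<beta>}" "T \<noteq> \<beta>" using end_in by (auto simp: Z_def)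
    then have T: "\<alpha> \<le> T" "T < \<beta>" by auto
    have after: "c t \<in> U \<and> \<phi> (c t) \<in> ball x0 \<rho>" if "t \<in> {T<..\<beta>}" for t
    proof (rule ccontr)
      assume "\<not> ?thesis"
      then have "t \<in> Z" using that T by (auto simp: Z_def)
      then have "t \<le> T" unfolding T_def using bdd by (rule cSup_upper)
      then show False using that by simp
    qed
    let ?K = "{t \<in> {\<alpha>..\<beta>}. c t \<in> {p \<in> U. \<phi> p \<in> cball x0 \<rho>}}"
    have "closedin (top_of_set {\<alpha>..\<beta>}) ?K"
      using closedin_continuous_map_preimage[OF c closedin_chart_preimage_compact[OF ch compact_cball sub]]
      by simp
    then have "closed ?K" by (rule closedin_closed_trans) simp
    moreover have "{T<..\<beta>} \<subseteq> ?K" using after T by (auto simp: less_imp_le)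
    \<comment> \<open>The closure adds \<open>T\<close>, which puts \<open>c T\<close> into
      \<open>U\<close> and the closed ball; since \<open>T \<in> Z\<close>, it must then lie on the
      sphere.\<close>
    ultimately have "closure {T<..\<beta>} \<subseteq> ?K" by (rule closure_minimal[rotated])
    then have K: "{T..\<beta>} \<subseteq> ?K" using T by simp
    moreover have "dist x0 (\<phi> (c T)) = \<rho>"
      using K T \<open>T \<in> Z\<close> by (force simp: Z_def)
    ultimately show False using not_all T by auto
  qed
  then show "\<forall>t\<in>{\<alpha>..\<beta>}. c t \<in> U \<and> \<phi> (c t) \<in> ball x0 \<rho>" by (auto simp: Z_def)
qed

end

section \<open>Gluing C1 pieces; connectedness by piecewise C1 curves\<close>

lemma C1_curve_cong:
  assumes "C1_curve X \<A> c \<alpha> \<beta>" and eq: "\<And>t. t \<in> {\<alpha>..\<beta>} \<Longrightarrow> c' t = c t"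
  shows "C1_curve X \<A> c' \<alpha> \<beta>"
  unfolding C1_curve_def
proof (intro conjI ballI; clarify?)
  show "continuous_map (top_of_set {\<alpha>..\<beta>}) X c'"
    by (rule continuous_map_eq[of _ _ c]) (use assms in \<open>auto simp: C1_curve_def\<close>)
next
  fix U \<phi> assume "(U, \<phi>) \<in> \<A>"
  then obtain D where D: "continuous_on ({\<alpha>..\<beta>} \<inter> c -` U) D"
    "\<And>t. t \<in> {\<alpha>..\<beta>} \<inter> c -` U \<Longrightarrow> ((\<phi> \<circ> c) has_vector_derivative D t) (at t within {\<alpha>..\<beta>})"
    using assms(1) unfolding C1_curve_def by blast
  have "{\<alpha>..\<beta>} \<inter> c' -` U = {\<alpha>..\<beta>} \<inter> c -` U" using eq by auto
  moreover have "((\<phi> \<circ> c') has_vector_derivative D t) (at t within {\<alpha>..\<beta>})"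
    if "t \<in> {\<alpha>..\<beta>} \<inter> c -` U" for t
    by (rule has_vector_derivative_transform[OF _ _ D(2)[OF that]]) (use that eq in auto)
  ultimately show "\<exists>D. continuous_on ({\<alpha>..\<beta>} \<inter> c' -` U) D \<and>
    (\<forall>t\<in>{\<alpha>..\<beta>} \<inter> c' -` U. ((\<phi> \<circ> c') has_vector_derivative D t) (at t within {\<alpha>..\<beta>}))"
    using D(1) by auto
qed

lemma piecewise_C1_curve_if_C1_curve:
  assumes "C1_curve X \<A> c \<alpha> \<beta>" "\<alpha> < \<beta>"
  shows "piecewise_C1_curve X \<A> c \<alpha> \<beta>"
  unfolding piecewise_C1_curve_def
  by (intro conjI exI[of _ "1::nat"] exI[of _ "\<lambda>i::nat. if i = 0 then \<alpha> else \<beta>"]) (use assms in auto)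

lemma piecewise_C1_curve_append:
  assumes c: "piecewise_C1_curve X \<A> c \<alpha> \<beta>" and c2: "C1_curve X \<A> c2 \<beta> \<beta>'"
    and "\<beta> < \<beta>'" "c2 \<beta> = c \<beta>"
  shows "piecewise_C1_curve X \<A> (\<lambda>t. if t \<le> \<beta> then c t else c2 t) \<alpha> \<beta>'"
proof -
  let ?c = "\<lambda>t. if t \<le> \<beta> then c t else c2 t"
  obtain n \<tau> where "\<alpha> < \<beta>" and \<tau>: "\<tau> 0 = \<alpha>" "\<tau> n = \<beta>"
    and pieces: "\<And>i. i < n \<Longrightarrow> \<tau> i < \<tau> (Suc i)" "\<And>i. i < n \<Longrightarrow> C1_curve X \<A> c (\<tau> i) (\<tau> (Suc i))"
    using c unfolding piecewise_C1_curve_def by blast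
  have mono: "\<tau> i \<le> \<beta>" if "i \<le> n" for i
    using that
  proof (induction rule: inc_induct)
    case (step m)
    then show ?case using pieces(1)[of m] by linarith
  qed (simp add: \<tau>)
  define \<sigma> where "\<sigma> i = (if i \<le> n then \<tau> i else \<beta>')" for i
  have steps: "\<sigma> i < \<sigma> (Suc i) \<and> C1_curve X \<A> ?c (\<sigma> i) (\<sigma> (Suc i))" if "i < Suc n" for i
  proof (cases "i = n")
    case True
    \<comment> \<open>At the joint \<open>\<beta>\<close> the glued curve takes the value of
      \<open>c\<close>; the hypothesis on \<open>c2 \<beta>\<close> makes it agree with
      \<open>c2\<close> on the whole closed piece, and derivatives are taken within that
      piece.\<close>
    have "C1_curve X \<A> ?c \<beta> \<beta>'"
      by (rule C1_curve_cong[OF c2]) (use \<open>c2 \<beta> = c \<beta>\<close> in auto)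
    then show ?thesis using True \<open>\<beta> < \<beta>'\<close> \<tau> by (simp add: \<sigma>_def)
  next
    case False
    with that have "i < n" by simp
    have "C1_curve X \<A> ?c (\<tau> i) (\<tau> (Suc i))"
      by (rule C1_curve_cong[OF pieces(2)[OF \<open>i < n\<close>]]) (use mono[of "Suc i"] \<open>i < n\<close> in auto)
    then show ?thesis using pieces(1)[OF \<open>i < n\<close>] \<open>i < n\<close> by (simp add: \<sigma>_def)
  qed
  have ends: "\<alpha> < \<beta>'" "\<sigma> 0 = \<alpha>" "\<sigma> (Suc n) = \<beta>'"
    using \<tau> \<open>\<alpha> < \<beta>\<close> \<open>\<beta> < \<beta>'\<close> by (auto simp: \<sigma>_def)
  show ?thesis
    unfolding piecewise_C1_curve_def
  proof (intro conjI exI allI impI)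
    show "\<alpha> < \<beta>'" "\<sigma> 0 = \<alpha>" "\<sigma> (Suc n) = \<beta>'" by (rule ends)+
    show "\<sigma> i < \<sigma> (Suc i)" "C1_curve X \<A> ?c (\<sigma> i) (\<sigma> (Suc i))" if "i < Suc n" for i
      using steps[OF that] by auto
  qed
qed

context smooth_manifold
begin

lemma C1_curve_continuous_in_chart:
  assumes "C1_curve X \<A> c \<alpha> \<beta>" "(U, \<phi>) \<in> \<A>"
  shows "continuous_on ({\<alpha>..\<beta>} \<inter> c -` U) (\<phi> \<circ> c)"
proof -
  obtain D where
    "\<And>t. t \<in> {\<alpha>..\<beta>} \<inter> c -` U \<Longrightarrow> ((\<phi> \<circ> c) has_vector_derivative D t) (at t within {\<alpha>..\<beta>})"
    using assms unfolding C1_curve_def by blast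
  then show ?thesis
    by (intro continuous_on_vector_derivative[of _ _ D])
      (auto intro: has_vector_derivative_within_subset)
qed

lemma piecewise_C1_curve_continuous:
  assumes "piecewise_C1_curve X \<A> c \<alpha> \<beta>"
  shows "continuous_map (top_of_set {\<alpha>..\<beta>}) X c"
proof -
  obtain n \<tau> where \<tau>: "\<tau> 0 = \<alpha>" "\<tau> n = \<beta>"
    and pieces: "\<And>i. i < n \<Longrightarrow> \<tau> i < \<tau> (Suc i)" "\<And>i. i < n \<Longrightarrow> C1_curve X \<A> c (\<tau> i) (\<tau> (Suc i))"
    using assms unfolding piecewise_C1_curve_def by blast
  \<comment> \<open>Continuity on the degenerate interval at \<open>i = 0\<close> would already need
    \<open>c \<alpha> \<in> topspace X\<close>, which only the first piece supplies.\<close>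
  have "\<alpha> \<le> \<tau> i \<and> (i > 0 \<longrightarrow> continuous_map (top_of_set {\<alpha>..\<tau> i}) X c)" if "i \<le> n" for i
    using that
  proof (induction i)
    case 0
    then show ?case by (simp add: \<tau>)
  next
    case (Suc i)
    then have IH: "\<alpha> \<le> \<tau> i" "i > 0 \<longrightarrow> continuous_map (top_of_set {\<alpha>..\<tau> i}) X c"
      and lt: "\<tau> i < \<tau> (Suc i)" and new: "continuous_map (top_of_set {\<tau> i..\<tau> (Suc i)}) X c"
      using pieces[of i] by (auto simp: C1_curve_def)
    have "continuous_map (top_of_set {\<alpha>..\<tau> (Suc i)}) X c"
    proof (cases "i = 0")
      case True
      then show ?thesis using new \<tau> by simp
    next
      case False
      \<comment> \<open>Both branches are \<open>c\<close>; the conditional only gives the shape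
        that the pasting lemma expects.\<close>
      have "continuous_map (top_of_set {\<alpha>..\<tau> (Suc i)}) X (\<lambda>t. if t \<le> \<tau> i then c t else c t)"
      proof (rule continuous_map_cases_le)
        have "{t \<in> topspace (top_of_set {\<alpha>..\<tau> (Suc i)}). t \<le> \<tau> i} = {\<alpha>..\<tau> i}"
          "{t \<in> topspace (top_of_set {\<alpha>..\<tau> (Suc i)}). \<tau> i \<le> t} = {\<tau> i..\<tau> (Suc i)}"
          using lt IH(1) by auto
        then show "continuous_map (subtopology (top_of_set {\<alpha>..\<tau> (Suc i)})
            {t \<in> topspace (top_of_set {\<alpha>..\<tau> (Suc i)}). t \<le> \<tau> i}) X c"
          "continuous_map (subtopology (top_of_set {\<alpha>..\<tau> (Suc i)})
            {t \<in> topspace (top_of_set {\<alpha>..\<tau> (Suc i)}). \<tau> i \<le> t}) X c"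
          using IH False new lt by (auto simp: subtopology_subtopology Int_absorb1)
      qed auto
      then show ?thesis by simp
    qed
    then show ?case using IH(1) lt by simp
  qed
  from this[of n] show ?thesis using \<tau> assms by (cases "n = 0") (auto simp: piecewise_C1_curve_def)
qed

text \<open>A segment that is straight in one chart is C1 in every chart: its velocity there is the
  image of the constant vector \<open>y - x\<close> under the derivative of the transition. The
  starting time is free so that the segment can be appended to a given curve.\<close>

lemma segment_C1_curve:
  fixes \<alpha> :: real
  assumes ch: "(U, \<phi>) \<in> \<A>" and seg: "closed_segment x y \<subseteq> \<phi> ` U"
  defines "c \<equiv> \<lambda>t. inv_into U \<phi> (x + (t - \<alpha>) *\<^sub>R (y - x))"
  shows "C1_curve X \<A> c \<alpha> (\<alpha> + 1)" "c \<alpha> = inv_into U \<phi> x" "c (\<alpha> + 1) = inv_into U \<phi> y"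
    "\<And>t. t \<in> {\<alpha>..\<alpha> + 1} \<Longrightarrow> c t \<in> U \<and> \<phi> (c t) \<in> closed_segment x y \<and>
      ((\<phi> \<circ> c) has_vector_derivative y - x) (at t within {\<alpha>..\<alpha> + 1})"
proof -
  define l where "l t = x + (t - \<alpha>) *\<^sub>R (y - x)" for t
  have l_seg: "l t \<in> closed_segment x y" if "t \<in> {\<alpha>..\<alpha> + 1}" for t
    unfolding closed_segment_def l_def using that
    by (intro CollectI exI[of _ "t - \<alpha>"]) (auto simp: algebra_simps)
  have \<phi>c: "\<phi> (c t) = l t" and c_U: "c t \<in> U" if "t \<in> {\<alpha>..\<alpha> + 1}" for t
    using l_seg[OF that] seg unfolding c_def l_def by (auto simp: f_inv_into_f inv_into_into subset_iff)
  have l_deriv: "(l has_vector_derivative y - x) (at t within S)" for t S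
    unfolding l_def by (auto intro!: derivative_eq_intros)
  have l_cont: "continuous_on S l" for S
    unfolding l_def by (intro continuous_intros)
  have deriv: "((\<phi> \<circ> c) has_vector_derivative y - x) (at t within {\<alpha>..\<alpha> + 1})"
    if "t \<in> {\<alpha>..\<alpha> + 1}" for t
    by (rule has_vector_derivative_transform[OF that _ l_deriv]) (simp add: \<phi>c)
  show "c t \<in> U \<and> \<phi> (c t) \<in> closed_segment x y \<and>
      ((\<phi> \<circ> c) has_vector_derivative y - x) (at t within {\<alpha>..\<alpha> + 1})"
    if "t \<in> {\<alpha>..\<alpha> + 1}" for t
    using c_U[OF that] \<phi>c[OF that] l_seg[OF that] deriv[OF that] by simp
  have "continuous_map (top_of_set {\<alpha>..\<alpha> + 1}) (top_of_set (\<phi> ` U)) l"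
    using l_cont l_seg seg by (auto simp: continuous_map_in_subtopology)
  from continuous_map_compose[OF this chart_inverse_continuous[OF ch]]
  have cont: "continuous_map (top_of_set {\<alpha>..\<alpha> + 1}) X c"
    by (simp add: c_def l_def o_def)
  show "C1_curve X \<A> c \<alpha> (\<alpha> + 1)"
    unfolding C1_curve_def
  proof (intro conjI cont ballI, clarify)
    fix V \<psi> assume V: "(V, \<psi>) \<in> \<A>"
    let ?D = "\<lambda>t. frechet_derivative (transition (U, \<phi>) (V, \<psi>)) (at (l t)) (y - x)"
    have "continuous_on ({\<alpha>..\<alpha> + 1} \<inter> c -` V) ?D"
    proof (rule continuous_on_compose2[OF transition_derivative_continuous[OF ch V] l_cont])
      show "l ` ({\<alpha>..\<alpha> + 1} \<inter> c -` V) \<subseteq> \<phi> ` (U \<inter> V)"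
        using c_U \<phi>c by (force simp: image_iff)
    qed
    moreover have "((\<psi> \<circ> c) has_vector_derivative ?D t) (at t within {\<alpha>..\<alpha> + 1})"
      if "t \<in> {\<alpha>..\<alpha> + 1} \<inter> c -` V" for t
      using curve_derivative_change_chart[OF cont _ _ ch V deriv, of t] that c_U[of t] \<phi>c[of t] by simp
    ultimately show "\<exists>D. continuous_on ({\<alpha>..\<alpha> + 1} \<inter> c -` V) D \<and>
      (\<forall>t\<in>{\<alpha>..\<alpha> + 1} \<inter> c -` V. ((\<psi> \<circ> c) has_vector_derivative D t) (at t within {\<alpha>..\<alpha> + 1}))"
      by blast
  qed
  show "c \<alpha> = inv_into U \<phi> x" "c (\<alpha> + 1) = inv_into U \<phi> y" by (simp_all add: c_def)
qed

lemma ex_C1_connected_neighbourhood: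
  assumes "q \<in> topspace X"
  obtains W where "openin X W" "q \<in> W"
    "\<And>x y \<alpha>. x \<in> W \<Longrightarrow> y \<in> W \<Longrightarrow> \<exists>c. C1_curve X \<A> c \<alpha> (\<alpha> + 1) \<and> c \<alpha> = x \<and> c (\<alpha> + 1) = y"
proof -
  obtain U \<phi> where U: "(U, \<phi>) \<in> \<A>" "q \<in> U" using ex_chart[OF assms] .
  obtain r where r: "r > 0" "ball (\<phi> q) r \<subseteq> \<phi> ` U"
    using chart_image[OF U(1)] U(2) by (meson imageI openE)
  show thesis
  proof (rule that)
    show "openin X {p \<in> U. \<phi> p \<in> ball (\<phi> q) r}" by (rule openin_chart_preimage[OF U(1) open_ball])
    show "q \<in> {p \<in> U. \<phi> p \<in> ball (\<phi> q) r}" using U r by simp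
    fix x y \<alpha> assume xy: "x \<in> {p \<in> U. \<phi> p \<in> ball (\<phi> q) r}" "y \<in> {p \<in> U. \<phi> p \<in> ball (\<phi> q) r}"
    then have "closed_segment (\<phi> x) (\<phi> y) \<subseteq> \<phi> ` U"
      using closed_segment_subset[OF _ _ convex_ball, of "\<phi> x" "\<phi> q" r "\<phi> y"] r(2) by blast
    from segment_C1_curve(1-3)[OF U(1) this, of \<alpha>]
    show "\<exists>c. C1_curve X \<A> c \<alpha> (\<alpha> + 1) \<and> c \<alpha> = x \<and> c (\<alpha> + 1) = y"
      using xy chart_inj[OF U(1)] by (intro exI conjI) (assumption, simp_all)
  qed
qed

text \<open>The points reachable from \<open>p\<close> form a clopen set, since a neighbourhood
  joined by C1 curves is reached entirely or not at all. Thus the set of lengths in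
  \<open>riemannian_dist\<close> is nonempty, and lower bounds of it pass to its
  \<open>Inf\<close>.\<close>

lemma connected_imp_piecewise_C1_connected:
  assumes "connected_space X" "p \<in> topspace X" "q \<in> topspace X"
  shows "\<exists>c \<alpha> \<beta>. piecewise_C1_curve X \<A> c \<alpha> \<beta> \<and> c \<alpha> = p \<and> c \<beta> = q"
proof -
  define R where "R = {q \<in> topspace X. \<exists>c \<alpha> \<beta>. piecewise_C1_curve X \<A> c \<alpha> \<beta> \<and> c \<alpha> = p \<and> c \<beta> = q}"
  have extend: "y \<in> R" if "openin X W" "x \<in> R" "x \<in> W" "y \<in> W"
    and W: "\<And>x y \<alpha>. x \<in> W \<Longrightarrow> y \<in> W \<Longrightarrow> \<exists>c. C1_curve X \<A> c \<alpha> (\<alpha> + 1) \<and> c \<alpha> = x \<and> c (\<alpha> + 1) = y"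
    for W x y
  proof -
    obtain c \<alpha> \<beta> where c: "piecewise_C1_curve X \<A> c \<alpha> \<beta>" "c \<alpha> = p" "c \<beta> = x"
      using \<open>x \<in> R\<close> by (auto simp: R_def)
    obtain c2 where c2: "C1_curve X \<A> c2 \<beta> (\<beta> + 1)" "c2 \<beta> = x" "c2 (\<beta> + 1) = y"
      using W[OF \<open>x \<in> W\<close> \<open>y \<in> W\<close>] by blast
    have "\<alpha> < \<beta>" using c(1) by (simp add: piecewise_C1_curve_def)
    have "piecewise_C1_curve X \<A> (\<lambda>t. if t \<le> \<beta> then c t else c2 t) \<alpha> (\<beta> + 1)"
      by (rule piecewise_C1_curve_append[OF c(1) c2(1)]) (use c c2 in auto)
    moreover have "(if \<alpha> \<le> \<beta> then c \<alpha> else c2 \<alpha>) = p" "(if \<beta> + 1 \<le> \<beta> then c (\<beta> + 1) else c2 (\<beta> + 1)) = y"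
      using c c2 \<open>\<alpha> < \<beta>\<close> by auto
    moreover have "y \<in> topspace X" using that openin_subset by blast
    ultimately show ?thesis unfolding R_def by blast
  qed
  have "openin X R"
    unfolding openin_subopen[of X R]
  proof
    fix x assume "x \<in> R"
    then have "x \<in> topspace X" by (simp add: R_def)
    then obtain W where "openin X W" "x \<in> W"
      "\<And>x y \<alpha>. x \<in> W \<Longrightarrow> y \<in> W \<Longrightarrow> \<exists>c. C1_curve X \<A> c \<alpha> (\<alpha> + 1) \<and> c \<alpha> = x \<and> c (\<alpha> + 1) = y"
      using ex_C1_connected_neighbourhood by blast
    with extend[of W x] \<open>x \<in> R\<close> show "\<exists>T. openin X T \<and> x \<in> T \<and> T \<subseteq> R" by blast
  qed
  moreover have "openin X (topspace X - R)"
    unfolding openin_subopen[of X "topspace X - R"]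
  proof
    fix x assume x: "x \<in> topspace X - R"
    then obtain W where W: "openin X W" "x \<in> W"
      "\<And>x y \<alpha>. x \<in> W \<Longrightarrow> y \<in> W \<Longrightarrow> \<exists>c. C1_curve X \<A> c \<alpha> (\<alpha> + 1) \<and> c \<alpha> = x \<and> c (\<alpha> + 1) = y"
      using ex_C1_connected_neighbourhood by blast
    then have "W \<subseteq> topspace X - R" using extend[of W _ x] x openin_subset[OF W(1)] by blast
    with W show "\<exists>T. openin X T \<and> x \<in> T \<and> T \<subseteq> topspace X - R" by blast
  qed
  moreover have "R \<subseteq> topspace X" by (auto simp: R_def)
  ultimately have "R = {} \<or> R = topspace X"
    using \<open>connected_space X\<close> unfolding connected_space_clopen_in closedin_def by blast
  \<comment> \<open>Curves have nondegenerate domains, so \<open>p\<close> is reached by a C1 curve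
    from \<open>p\<close> to itself.\<close>
  moreover have "p \<in> R"
  proof -
    obtain W where "openin X W" "p \<in> W"
      and W: "\<And>x y \<alpha>. x \<in> W \<Longrightarrow> y \<in> W \<Longrightarrow> \<exists>c. C1_curve X \<A> c \<alpha> (\<alpha> + 1) \<and> c \<alpha> = x \<and> c (\<alpha> + 1) = y"
      using ex_C1_connected_neighbourhood[OF assms(2)] by blast
    obtain c where c: "C1_curve X \<A> c 0 (0 + 1)" "c 0 = p" "c (0 + 1) = p"
      using W[OF \<open>p \<in> W\<close> \<open>p \<in> W\<close>, of 0] by blast
    have "piecewise_C1_curve X \<A> c 0 (0 + 1)"
      by (rule piecewise_C1_curve_if_C1_curve[OF c(1)]) simp
    then show ?thesis using c(2,3) assms(2) unfolding R_def by blast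
  qed
  ultimately show ?thesis using assms(3) unfolding R_def by blast
qed

end

section \<open>Local comparison of the Riemannian distance with a Euclidean one\<close>

context riemannian_manifold
begin

text \<open>The integrand of \<open>curve_length\<close>, with the set for the derivative as a
  parameter: the whole curve uses \<open>{\<alpha>..\<beta>}\<close>, a C1 piece its own interval,
  and on that piece the two can differ only at its ends.\<close>

definition speed :: "(real \<Rightarrow> 'a) \<Rightarrow> real set \<Rightarrow> real \<Rightarrow> real" where
  "speed c S t = (let ch = chart_at \<A> (c t);
     v = vector_derivative (snd ch \<circ> c) (at t within S) in sqrt (g ch (c t) v v))"

lemma curve_length_eq_integral_speed:
  "curve_length \<A> g c \<alpha> \<beta> = integral {\<alpha>..\<beta>} (speed c {\<alpha>..\<beta>})"
  unfolding curve_length_def speed_def ..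

lemma inner_form_metric:
  assumes "(U, \<phi>) \<in> \<A>" "p \<in> U"
  shows "inner_form (g (U, \<phi>) p)"
  using assms by unfold_locales (blast intro: metric_bilinear metric_sym metric_pos)+

lemma speed_nonneg:
  assumes "c t \<in> topspace X"
  shows "speed c S t \<ge> 0"
proof -
  obtain U \<phi> where ch: "chart_at \<A> (c t) = (U, \<phi>)" by (cases "chart_at \<A> (c t)")
  then have "(U, \<phi>) \<in> \<A>" "c t \<in> U" using chart_at_valid[OF assms] by auto
  from inner_form.nonneg[OF inner_form_metric[OF this]] show ?thesis
    by (simp add: speed_def ch Let_def)
qed

text \<open>\<open>chart_at\<close> makes an arbitrary choice at each point. The transformation law
  allows any convenient chart instead; the estimates of length rest on this.\<close>

lemma speed_in_chart:
  assumes "\<alpha> < \<beta>" "t \<in> {\<alpha>..\<beta>}" and c: "continuous_map (top_of_set {\<alpha>..\<beta>}) X c"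
    and U: "(U, \<phi>) \<in> \<A>" "c t \<in> U"
    and v: "((\<phi> \<circ> c) has_vector_derivative v) (at t within {\<alpha>..\<beta>})"
  shows "speed c {\<alpha>..\<beta>} t = sqrt (g (U, \<phi>) (c t) v v)"
proof -
  have "c t \<in> topspace X" using U chart_domain_subset by blast
  obtain V \<psi> where ch: "chart_at \<A> (c t) = (V, \<psi>)" by (cases "chart_at \<A> (c t)")
  then have V: "(V, \<psi>) \<in> \<A>" "c t \<in> V" using chart_at_valid[OF \<open>c t \<in> topspace X\<close>] by auto
  have "vector_derivative (\<psi> \<circ> c) (at t within {\<alpha>..\<beta>}) =
      frechet_derivative (transition (U, \<phi>) (V, \<psi>)) (at (\<phi> (c t))) v"
    using curve_derivative_change_chart[OF c assms(2) _ U(1) V(1) v] U V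
    by (intro vector_derivative_within_closed_interval assms(1,2)) simp
  then show ?thesis
    using metric_transform[OF U(1) V(1), of "c t" v v] U V by (simp add: speed_def ch Let_def)
qed

text \<open>\<open>metric_smooth\<close> concerns fixed vectors only. Expansion in the basis reduces
  varying vectors to finitely many coefficients with fixed ones.\<close>

lemma metric_continuous_on:
  assumes U: "(U, \<phi>) \<in> \<A>" and x: "continuous_on S x" "x ` S \<subseteq> \<phi> ` U"
    and "continuous_on S v" "continuous_on S w"
  shows "continuous_on S (\<lambda>s. g (U, \<phi>) (inv_into U \<phi> (x s)) (v s) (w s))"
proof -
  have coeff: "continuous_on S (\<lambda>s. g (U, \<phi>) (inv_into U \<phi> (x s)) i j)" for i j
  proof (rule continuous_on_compose2[OF _ x])
    have "Ck_on 0 (\<phi> ` U) (\<lambda>x. g (U, \<phi>) (inv_into U \<phi> x) i j)"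
      using metric_smooth[OF U, of i j] unfolding smooth_on_def by blast
    then show "continuous_on (\<phi> ` U) (\<lambda>x. g (U, \<phi>) (inv_into U \<phi> x) i j)" by simp
  qed
  have "continuous_on S (\<lambda>s. \<Sum>i\<in>Basis. \<Sum>j\<in>Basis. (v s \<bullet> i) * (w s \<bullet> j) *
      g (U, \<phi>) (inv_into U \<phi> (x s)) i j)"
    by (intro continuous_intros coeff assms)
  then show ?thesis
  proof (rule continuous_on_eq)
    fix s assume "s \<in> S"
    then have "inv_into U \<phi> (x s) \<in> U" using x(2) by (intro inv_into_into) blast
    then show "(\<Sum>i\<in>Basis. \<Sum>j\<in>Basis. (v s \<bullet> i) * (w s \<bullet> j) * g (U, \<phi>) (inv_into U \<phi> (x s)) i j)
        = g (U, \<phi>) (inv_into U \<phi> (x s)) (v s) (w s)"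
      by (intro bilinear_Basis_expansion[symmetric] metric_bilinear[OF U])
  qed
qed

lemma speed_continuous:
  assumes c: "C1_curve X \<A> c \<alpha> \<beta>" and "\<alpha> < \<beta>"
  shows "continuous_on {\<alpha>..\<beta>} (speed c {\<alpha>..\<beta>})"
  unfolding continuous_on_eq_continuous_within
proof
  fix t assume t: "t \<in> {\<alpha>..\<beta>}"
  have cont: "continuous_map (top_of_set {\<alpha>..\<beta>}) X c" using c by (simp add: C1_curve_def)
  then have "c t \<in> topspace X" using t by (auto simp: continuous_map_def)
  then obtain U \<phi> where U: "(U, \<phi>) \<in> \<A>" "c t \<in> U" using ex_chart by blast
  let ?S = "{\<alpha>..\<beta>} \<inter> c -` U"
  obtain D where D: "continuous_on ?S D"
    "\<And>t. t \<in> ?S \<Longrightarrow> ((\<phi> \<circ> c) has_vector_derivative D t) (at t within {\<alpha>..\<beta>})"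
    using c U(1) unfolding C1_curve_def by blast
  have "continuous_on ?S (\<lambda>s. sqrt (g (U, \<phi>) (inv_into U \<phi> ((\<phi> \<circ> c) s)) (D s) (D s)))"
    by (intro continuous_on_real_sqrt metric_continuous_on[OF U(1)] D(1)
        C1_curve_continuous_in_chart[OF c U(1)]) auto
  then have "continuous_on ?S (speed c {\<alpha>..\<beta>})"
  proof (rule continuous_on_eq)
    fix s assume "s \<in> ?S"
    then show "sqrt (g (U, \<phi>) (inv_into U \<phi> ((\<phi> \<circ> c) s)) (D s) (D s)) = speed c {\<alpha>..\<beta>} s"
      using speed_in_chart[OF \<open>\<alpha> < \<beta>\<close> _ cont U(1) _ D(2), of s] chart_inj[OF U(1)] by simp
  qed
  then have "continuous (at t within ?S) (speed c {\<alpha>..\<beta>})"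
    using t U by (simp add: continuous_on_eq_continuous_within)
  \<comment> \<open>The chart selected by \<open>chart_at\<close> may jump along the curve, so
    continuity is shown in one chart; near \<open>t\<close> the curve stays in \<open>U\<close>, and
    the restriction to such times is harmless.\<close>
  moreover have "at t within ?S = at t within {\<alpha>..\<beta>}"
  proof -
    obtain \<delta> where \<delta>: "\<delta> > 0" "\<And>s. s \<in> {\<alpha>..\<beta>} \<Longrightarrow> dist s t < \<delta> \<Longrightarrow> c s \<in> U"
      using curve_preimage_ball[OF cont chart_domain[OF U(1)] t U(2)] by blast
    show ?thesis
      by (rule at_within_nhd[of t "ball t \<delta>"]) (use \<delta> in \<open>auto simp: dist_commute\<close>)
  qed
  ultimately show "continuous (at t within {\<alpha>..\<beta>}) (speed c {\<alpha>..\<beta>})" by simp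
qed

lemma speed_integrable:
  assumes "piecewise_C1_curve X \<A> c \<alpha> \<beta>"
  shows "speed c {\<alpha>..\<beta>} integrable_on {\<alpha>..\<beta>}"
proof -
  obtain n \<tau> where "\<alpha> < \<beta>" and \<tau>: "\<tau> 0 = \<alpha>" "\<tau> n = \<beta>"
    and pieces: "\<And>i. i < n \<Longrightarrow> \<tau> i < \<tau> (Suc i)" "\<And>i. i < n \<Longrightarrow> C1_curve X \<A> c (\<tau> i) (\<tau> (Suc i))"
    using assms unfolding piecewise_C1_curve_def by blast
  have le: "\<tau> i \<le> \<beta>" if "i \<le> n" for i
    using that
  proof (induction rule: inc_induct)
    case (step m)
    then show ?case using pieces(1)[of m] by linarith
  qed (simp add: \<tau>)
  have "\<alpha> \<le> \<tau> i \<and> speed c {\<alpha>..\<beta>} integrable_on {\<alpha>..\<tau> i}" if "i \<le> n" for i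
    using that
  proof (induction i)
    case 0
    then show ?case by (simp add: \<tau> integrable_on_refl[of _ \<alpha>, simplified])
  next
    case (Suc i)
    then have IH: "\<alpha> \<le> \<tau> i" "speed c {\<alpha>..\<beta>} integrable_on {\<alpha>..\<tau> i}" and "i < n" by auto
    note piece = pieces[OF \<open>i < n\<close>]
    have "speed c {\<tau> i..\<tau> (Suc i)} integrable_on {\<tau> i..\<tau> (Suc i)}"
      using speed_continuous[OF piece(2,1)] by (rule integrable_continuous_real)
    then have "speed c {\<alpha>..\<beta>} integrable_on {\<tau> i..\<tau> (Suc i)}"
    \<comment> \<open>Inside the piece both derivatives are two-sided and agree. At its ends the
      derivative within \<open>{\<alpha>..\<beta>}\<close> may fail to exist, but two points do not
      affect integrability.\<close>
    proof (rule integrable_spike_finite[of "{\<tau> i, \<tau> (Suc i)}", rotated 2])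
      fix t assume "t \<in> {\<tau> i..\<tau> (Suc i)} - {\<tau> i, \<tau> (Suc i)}"
      then have t: "\<tau> i < t" "t < \<tau> (Suc i)" by auto
      then have "at t within {\<tau> i..\<tau> (Suc i)} = at t"
        "at t within {\<alpha>..\<beta>} = at t"
        using IH(1) le[of "Suc i"] \<open>i < n\<close> by (auto intro!: at_within_interior)
      then show "speed c {\<alpha>..\<beta>} t = speed c {\<tau> i..\<tau> (Suc i)} t" by (simp add: speed_def)
    qed simp
    with IH piece(1) show ?case by (auto intro: Henstock_Kurzweil_Integration.integrable_combine[of \<alpha> "\<tau> i"])
  qed
  from this[of n] show ?thesis using \<tau> by simp
qed

lemma curve_length_nonneg:
  assumes "piecewise_C1_curve X \<A> c \<alpha> \<beta>"
  shows "curve_length \<A> g c \<alpha> \<beta> \<ge> 0"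
  unfolding curve_length_eq_integral_speed
proof (rule integral_nonneg[OF speed_integrable[OF assms]])
  fix t assume "t \<in> {\<alpha>..\<beta>}"
  then show "0 \<le> speed c {\<alpha>..\<beta>} t"
    using piecewise_C1_curve_continuous[OF assms] by (intro speed_nonneg) (auto simp: continuous_map_def)
qed

text \<open>The displacement \<open>u\<close> in the chart satisfies \<open>G u u = \<integral> G u (\<phi> \<circ> c)'\<close>, and Cauchy-Schwarz bounds
  the integrand by the length of \<open>u\<close> times the speed.\<close>

lemma displacement_le_curve_length:
  assumes c: "piecewise_C1_curve X \<A> c \<alpha> \<beta>" and T: "T \<in> {\<alpha>..\<beta>}" and U: "(U, \<phi>) \<in> \<A>"
    and in_U: "\<And>t. t \<in> {T..\<beta>} \<Longrightarrow> c t \<in> U"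
    and G: "inner_form G" and "\<kappa> > 0"
    and bound: "\<And>t v. t \<in> {T..\<beta>} \<Longrightarrow> \<kappa> * sqrt (G v v) \<le> sqrt (g (U, \<phi>) (c t) v v)"
  shows "\<kappa> * sqrt (G (\<phi> (c \<beta>) - \<phi> (c T)) (\<phi> (c \<beta>) - \<phi> (c T))) \<le> curve_length \<A> g c \<alpha> \<beta>"
proof -
  interpret G: inner_form G by (rule G)
  have bb: "bounded_bilinear G" using G.bilinear by (simp add: bilinear_conv_bounded_bilinear)
  define u where "u = \<phi> (c \<beta>) - \<phi> (c T)"
  define N where "N = sqrt (G u u)"
  have cont: "continuous_map (top_of_set {\<alpha>..\<beta>}) X c" by (rule piecewise_C1_curve_continuous[OF c])
  obtain n \<tau> where "\<alpha> < \<beta>" and \<tau>: "\<tau> 0 = \<alpha>" "\<tau> n = \<beta>"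
    and pieces: "\<And>i. i < n \<Longrightarrow> \<tau> i < \<tau> (Suc i)" "\<And>i. i < n \<Longrightarrow> C1_curve X \<A> c (\<tau> i) (\<tau> (Suc i))"
    using c unfolding piecewise_C1_curve_def by blast
  define S where "S = \<tau> ` {..n}"
  have "\<exists>v. ((\<phi> \<circ> c) has_vector_derivative v) (at t)" if t: "t \<in> {T<..<\<beta>} - S" for t
  proof -
    have "\<exists>i<n. \<tau> i < t \<and> t < \<tau> (Suc i)"
    proof (rule ccontr)
      assume no: "\<not> ?thesis"
      have "\<tau> i < t" if "i \<le> n" for i
        using that
      proof (induction i)
        case 0
        then show ?case using t T \<tau> by auto
      next
        case (Suc i)
        then have "\<tau> i < t" "\<not> t < \<tau> (Suc i)" "\<tau> (Suc i) \<noteq> t" using no t by (auto simp: S_def)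
        then show ?case by simp
      qed
      from this[of n] show False using \<tau> t by simp
    qed
    then obtain i where i: "i < n" "\<tau> i < t" "t < \<tau> (Suc i)" by blast
    have "c t \<in> U" using t by (intro in_U) auto
    then obtain v where "((\<phi> \<circ> c) has_vector_derivative v) (at t within {\<tau> i..\<tau> (Suc i)})"
      using pieces(2)[OF i(1)] U i unfolding C1_curve_def by fastforce
    moreover have "at t within {\<tau> i..\<tau> (Suc i)} = at t" using i by (intro at_within_interior) simp
    ultimately show ?thesis by auto
  qed
  then obtain v where v: "\<And>t. t \<in> {T<..<\<beta>} - S \<Longrightarrow> ((\<phi> \<circ> c) has_vector_derivative v t) (at t)"
    by metis
  have \<phi>c: "continuous_on {T..\<beta>} (\<phi> \<circ> c)"
  proof -
    have "continuous_map (top_of_set {T..\<beta>}) (subtopology X U) c"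
      using cont T in_U
      by (auto simp: continuous_map_in_subtopology intro: continuous_map_from_subtopology_mono)
    from continuous_map_compose[OF this chart_continuous[OF U]] show ?thesis by simp
  qed
  \<comment> \<open>The fundamental theorem is applied to a scalar function and tolerates the finite
    set \<open>S\<close> of breakpoints, where only continuity is at hand.\<close>
  have "((\<lambda>t. G u (v t)) has_integral G u ((\<phi> \<circ> c) \<beta>) - G u ((\<phi> \<circ> c) T)) {T..\<beta>}"
  proof (rule fundamental_theorem_of_calculus_interior_strong[of S])
    show "continuous_on {T..\<beta>} (\<lambda>t. G u ((\<phi> \<circ> c) t))"
      by (intro bounded_bilinear.continuous_on[OF bb] \<phi>c continuous_intros)
    show "((\<lambda>t. G u ((\<phi> \<circ> c) t)) has_vector_derivative G u (v t)) (at t)" if "t \<in> {T<..<\<beta>} - S" for t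
      by (rule bounded_linear.has_vector_derivative[OF bounded_bilinear.bounded_linear_right[OF bb] v[OF that]])
  qed (use T in \<open>auto simp: S_def\<close>)
  \<comment> \<open>\<open>v\<close> is unspecified at breakpoints and end points. With the value 0
    there, the comparison with the nonnegative speed holds at every time.\<close>
  then have "((\<lambda>t. if t \<in> {T<..<\<beta>} - S then G u (v t) else 0) has_integral G u u) {T..\<beta>}"
    by (rule has_integral_spike_finite[of "S \<union> {T, \<beta>}", rotated 2, THEN has_integral_eq_rhs])
      (auto simp: S_def u_def bilinear_rsub[OF G.bilinear])
  moreover have int: "speed c {\<alpha>..\<beta>} integrable_on {T..\<beta>}"
    using speed_integrable[OF c] by (rule integrable_on_subinterval) (use T in auto)
  then have "((\<lambda>t. (N / \<kappa>) * speed c {\<alpha>..\<beta>} t) has_integral (N / \<kappa>) * integral {T..\<beta>} (speed c {\<alpha>..\<beta>})) {T..\<beta>}"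
    by (intro has_integral_mult_right) auto
  moreover have "(if t \<in> {T<..<\<beta>} - S then G u (v t) else 0) \<le> (N / \<kappa>) * speed c {\<alpha>..\<beta>} t"
    if t: "t \<in> {T..\<beta>}" for t
  proof (cases "t \<in> {T<..<\<beta>} - S")
    case True
    have "at t within {\<alpha>..\<beta>} = at t" using True T by (intro at_within_interior) auto
    then have "speed c {\<alpha>..\<beta>} t = sqrt (g (U, \<phi>) (c t) (v t) (v t))"
      using t T v[OF True] by (intro speed_in_chart \<open>\<alpha> < \<beta>\<close> cont U in_U) auto
    then have "\<kappa> * sqrt (G (v t) (v t)) \<le> speed c {\<alpha>..\<beta>} t" using bound[OF t] by simp
    then have "sqrt (G (v t) (v t)) \<le> speed c {\<alpha>..\<beta>} t / \<kappa>" using \<open>\<kappa> > 0\<close> by (simp add: field_simps)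
    then have "N * sqrt (G (v t) (v t)) \<le> N * (speed c {\<alpha>..\<beta>} t / \<kappa>)"
      by (intro mult_left_mono) (auto simp: N_def G.nonneg)
    moreover have "G u (v t) \<le> N * sqrt (G (v t) (v t))"
      unfolding N_def by (rule G.Cauchy_Schwarz)
    ultimately show ?thesis using True by simp
  next
    case False
    have "speed c {\<alpha>..\<beta>} t \<ge> 0"
      using in_U[OF t] chart_domain_subset[OF U] by (intro speed_nonneg) auto
    then have "(N / \<kappa>) * speed c {\<alpha>..\<beta>} t \<ge> 0"
      using \<open>\<kappa> > 0\<close> by (intro mult_nonneg_nonneg divide_nonneg_pos) (auto simp: N_def G.nonneg)
    then show ?thesis by (simp only: False if_False)
  qed
  ultimately have "G u u \<le> (N / \<kappa>) * integral {T..\<beta>} (speed c {\<alpha>..\<beta>})"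
    by (rule has_integral_le)
  also have "\<dots> \<le> (N / \<kappa>) * curve_length \<A> g c \<alpha> \<beta>"
  proof (rule mult_left_mono)
    show "integral {T..\<beta>} (speed c {\<alpha>..\<beta>}) \<le> curve_length \<A> g c \<alpha> \<beta>"
      unfolding curve_length_eq_integral_speed
    proof (rule integral_subset_le[OF _ int speed_integrable[OF c]])
      show "\<forall>t\<in>{\<alpha>..\<beta>}. 0 \<le> speed c {\<alpha>..\<beta>} t"
        using cont by (auto simp: continuous_map_def intro!: speed_nonneg)
    qed (use T in auto)
    show "0 \<le> N / \<kappa>" using \<open>\<kappa> > 0\<close> by (simp add: N_def G.nonneg)
  qed
  finally have "N * (\<kappa> * N) \<le> N * curve_length \<A> g c \<alpha> \<beta>"
    using \<open>\<kappa> > 0\<close> G.nonneg[of u] by (simp add: N_def field_simps)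
  moreover have "N \<ge> 0" by (simp add: N_def G.nonneg)
  \<comment> \<open>One factor \<open>N\<close> cancels from \<open>G u u = N * N\<close>; for
    \<open>N = 0\<close> the claim is that lengths are nonnegative.\<close>
  ultimately have "\<kappa> * N \<le> curve_length \<A> g c \<alpha> \<beta>"
    using curve_length_nonneg[OF c] by (cases "N = 0") auto
  then show ?thesis by (simp add: N_def u_def)
qed

lemma metric_nearly_constant:
  assumes U: "(U, \<phi>) \<in> \<A>" "p0 \<in> U" and \<epsilon>: "0 < \<epsilon>" "\<epsilon> < 1"
  obtains R where "R > 0" "cball (\<phi> p0) R \<subseteq> \<phi> ` U"
    "\<And>p v. p \<in> U \<Longrightarrow> \<phi> p \<in> cball (\<phi> p0) R \<Longrightarrow>
      (1 - \<epsilon>) * sqrt (g (U, \<phi>) p0 v v) \<le> sqrt (g (U, \<phi>) p v v) \<and>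
      sqrt (g (U, \<phi>) p v v) \<le> (1 + \<epsilon>) * sqrt (g (U, \<phi>) p0 v v)"
proof -
  define G where "G = g (U, \<phi>) p0"
  interpret G: inner_form G unfolding G_def by (rule inner_form_metric[OF U])
  define n where "n = real DIM('e)"
  have n: "n > 0" by (simp add: n_def)
  obtain m M where m: "m > 0" "\<And>v. m * norm v \<le> sqrt (G v v)"
    using G.norm_equivalent by metis
  \<comment> \<open>There are \<open>n\<^sup>2\<close> coefficients. If each changes by at most
    \<open>\<eta>\<close>, the form changes at \<open>v\<close> by at most
    \<open>\<epsilon> * (m * norm v)\<^sup>2\<close>, hence by at most
    \<open>\<epsilon> * G v v\<close>.\<close>
  define \<eta> where "\<eta> = \<epsilon> * m\<^sup>2 / n\<^sup>2"
  have \<eta>: "\<eta> > 0" using m \<epsilon> n by (simp add: \<eta>_def)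
  have inv0: "inv_into U \<phi> (\<phi> p0) = p0" using U chart_inj by simp
  have "\<forall>\<^sub>F x in nhds (\<phi> p0). \<forall>i\<in>Basis. \<forall>j\<in>Basis. \<bar>g (U, \<phi>) (inv_into U \<phi> x) i j - G i j\<bar> < \<eta>"
  proof (intro eventually_ball_finite finite_Basis ballI)
    fix i j :: 'e
    have "continuous_on (\<phi> ` U) (\<lambda>x. g (U, \<phi>) (inv_into U \<phi> x) i j)"
      by (rule metric_continuous_on[OF U(1)]) (auto intro: continuous_intros)
    then have "isCont (\<lambda>x. g (U, \<phi>) (inv_into U \<phi> x) i j) (\<phi> p0)"
      using chart_image[OF U(1)] U(2) by (auto simp: continuous_on_eq_continuous_at)
    then have "((\<lambda>x. g (U, \<phi>) (inv_into U \<phi> x) i j) \<longlongrightarrow> G i j) (nhds (\<phi> p0))"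
      by (simp add: isCont_def tendsto_nhds_iff inv0 G_def)
    then show "\<forall>\<^sub>F x in nhds (\<phi> p0). \<bar>g (U, \<phi>) (inv_into U \<phi> x) i j - G i j\<bar> < \<eta>"
      using tendstoD[OF _ \<eta>] by (fastforce simp: dist_real_def)
  qed
  moreover have "\<forall>\<^sub>F x in nhds (\<phi> p0). x \<in> \<phi> ` U"
    using chart_image[OF U(1)] U(2) by (intro eventually_nhds_in_open) auto
  ultimately have "\<forall>\<^sub>F x in nhds (\<phi> p0). x \<in> \<phi> ` U \<and>
      (\<forall>i\<in>Basis. \<forall>j\<in>Basis. \<bar>g (U, \<phi>) (inv_into U \<phi> x) i j - G i j\<bar> < \<eta>)"
    by eventually_elim auto
  then obtain d where d: "d > 0" "\<And>x. dist x (\<phi> p0) < d \<Longrightarrow> x \<in> \<phi> ` U \<and>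
      (\<forall>i\<in>Basis. \<forall>j\<in>Basis. \<bar>g (U, \<phi>) (inv_into U \<phi> x) i j - G i j\<bar> < \<eta>)"
    by (auto simp: eventually_nhds_metric)
  show thesis
  proof (rule that[of "d / 2"])
    show "d / 2 > 0" using d by simp
    show "cball (\<phi> p0) (d / 2) \<subseteq> \<phi> ` U"
    proof
      fix x assume "x \<in> cball (\<phi> p0) (d / 2)"
      then show "x \<in> \<phi> ` U" using d(2)[of x] d(1) by (simp add: dist_commute)
    qed
    fix p v assume p: "p \<in> U" "\<phi> p \<in> cball (\<phi> p0) (d / 2)"
    interpret H: inner_form "g (U, \<phi>) p" by (rule inner_form_metric[OF U(1) p(1)])
    let ?H = "g (U, \<phi>) p"
    have coeff: "\<bar>?H i j - G i j\<bar> \<le> \<eta>" if "i \<in> Basis" "j \<in> Basis" for i j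
      using d(2)[of "\<phi> p"] d(1) p that chart_inj[OF U(1)] by (force simp: dist_commute)
    have "?H v v - G v v = (\<Sum>i\<in>Basis. \<Sum>j\<in>Basis. (v \<bullet> i) * (v \<bullet> j) * (?H i j - G i j))"
      unfolding bilinear_Basis_expansion[OF H.bilinear, of v v] bilinear_Basis_expansion[OF G.bilinear, of v v]
      by (simp add: sum_subtractf right_diff_distrib)
    also have "\<bar>\<dots>\<bar> \<le> (\<Sum>i\<in>(Basis::'e set). \<Sum>j\<in>(Basis::'e set). norm v * norm v * \<eta>)"
    proof (intro order_trans[OF sum_abs] sum_mono)
      fix i j :: 'e assume "i \<in> Basis" "j \<in> Basis"
      then show "\<bar>(v \<bullet> i) * (v \<bullet> j) * (?H i j - G i j)\<bar> \<le> norm v * norm v * \<eta>"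
        unfolding abs_mult by (intro mult_mono Basis_le_norm coeff) auto
    qed
    also have "\<dots> = n * (n * (norm v * norm v * \<eta>))" by (simp add: n_def)
    also have "\<dots> = \<epsilon> * (m * norm v)\<^sup>2" using n by (simp add: \<eta>_def power2_eq_square)
    also have "\<dots> \<le> \<epsilon> * (sqrt (G v v))\<^sup>2"
      using m \<epsilon> by (intro mult_left_mono power_mono) auto
    finally have diff: "\<bar>?H v v - G v v\<bar> \<le> \<epsilon> * G v v" by (simp add: G.nonneg)
    \<comment> \<open>The factors are weakened to perfect squares, so that the roots have the same
      relative error \<open>\<epsilon>\<close>.\<close>
    have "(1 - \<epsilon>)\<^sup>2 \<le> 1 - \<epsilon>" "1 + \<epsilon> \<le> (1 + \<epsilon>)\<^sup>2"
      using \<epsilon> mult_left_le[of "1 - \<epsilon>" "1 - \<epsilon>"] by (auto simp: power2_eq_square algebra_simps)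
    then have "(1 - \<epsilon>)\<^sup>2 * G v v \<le> (1 - \<epsilon>) * G v v" "(1 + \<epsilon>) * G v v \<le> (1 + \<epsilon>)\<^sup>2 * G v v"
      by (simp_all add: mult_right_mono G.nonneg)
    with diff have "(1 - \<epsilon>)\<^sup>2 * G v v \<le> ?H v v" "?H v v \<le> (1 + \<epsilon>)\<^sup>2 * G v v"
      unfolding left_diff_distrib distrib_right by linarith+
    then have "sqrt ((1 - \<epsilon>)\<^sup>2 * G v v) \<le> sqrt (?H v v)" "sqrt (?H v v) \<le> sqrt ((1 + \<epsilon>)\<^sup>2 * G v v)"
      by (simp_all only: real_sqrt_le_mono)
    then show "(1 - \<epsilon>) * sqrt (g (U, \<phi>) p0 v v) \<le> sqrt (g (U, \<phi>) p v v) \<and>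
      sqrt (g (U, \<phi>) p v v) \<le> (1 + \<epsilon>) * sqrt (g (U, \<phi>) p0 v v)"
      using \<epsilon> by (simp add: real_sqrt_mult G_def)
  qed
qed

section \<open>The distance as an infimum of lengths\<close>

lemma le_riemannian_dist:
  assumes "connected_space X" "p \<in> topspace X" "q \<in> topspace X"
    and "\<And>c \<alpha> \<beta>. piecewise_C1_curve X \<A> c \<alpha> \<beta> \<Longrightarrow> c \<alpha> = p \<Longrightarrow> c \<beta> = q \<Longrightarrow>
      l \<le> curve_length \<A> g c \<alpha> \<beta>"
  shows "l \<le> riemannian_dist X \<A> g p q"
proof -
  have "l \<le> Inf {curve_length \<A> g c \<alpha> \<beta> | c \<alpha> \<beta>.
      piecewise_C1_curve X \<A> c \<alpha> \<beta> \<and> c \<alpha> = p \<and> c \<beta> = q}"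
    by (rule cInf_greatest)
      (use assms(4) connected_imp_piecewise_C1_connected[OF assms(1-3)] in blast)+
  then show ?thesis using assms(2,3) by (simp add: riemannian_dist_def)
qed

lemma riemannian_dist_le:
  assumes c: "piecewise_C1_curve X \<A> c \<alpha> \<beta>"
  shows "riemannian_dist X \<A> g (c \<alpha>) (c \<beta>) \<le> curve_length \<A> g c \<alpha> \<beta>"
proof -
  have "\<alpha> \<le> \<beta>" using c by (simp add: piecewise_C1_curve_def)
  then have "c \<alpha> \<in> topspace X" "c \<beta> \<in> topspace X"
    using piecewise_C1_curve_continuous[OF c] by (auto simp: continuous_map_def)
  moreover have "Inf {curve_length \<A> g c' \<alpha>' \<beta>' | c' \<alpha>' \<beta>'.
      piecewise_C1_curve X \<A> c' \<alpha>' \<beta>' \<and> c' \<alpha>' = c \<alpha> \<and> c' \<beta>' = c \<beta>} \<le> curve_length \<A> g c \<alpha> \<beta>"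
    by (rule cInf_lower) (use c curve_length_nonneg in \<open>auto intro!: bdd_belowI[of _ 0]\<close>)
  ultimately show ?thesis by (simp add: riemannian_dist_def)
qed

lemma riemannian_dist_nonneg:
  assumes "connected_space X"
  shows "riemannian_dist X \<A> g p q \<ge> 0"
proof (cases "p \<in> topspace X \<and> q \<in> topspace X")
  case True
  then show ?thesis using le_riemannian_dist[OF assms] curve_length_nonneg by blast
qed (auto simp: riemannian_dist_def)

text \<open>The coordinate segment, run in unit time with constant velocity
  \<open>\<phi> q - \<phi> p\<close>, is a competitor whose speed never exceeds
  \<open>L\<close>.\<close>

lemma riemannian_dist_le_in_chart:
  assumes U: "(U, \<phi>) \<in> \<A>" "p \<in> U" "q \<in> U" and seg: "closed_segment (\<phi> p) (\<phi> q) \<subseteq> \<phi> ` U"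
    and bound: "\<And>p'. p' \<in> U \<Longrightarrow> \<phi> p' \<in> closed_segment (\<phi> p) (\<phi> q) \<Longrightarrow>
      sqrt (g (U, \<phi>) p' (\<phi> q - \<phi> p) (\<phi> q - \<phi> p)) \<le> L"
  shows "riemannian_dist X \<A> g p q \<le> L"
proof -
  define c where "c = (\<lambda>t. inv_into U \<phi> (\<phi> p + t *\<^sub>R (\<phi> q - \<phi> p)))"
  have c: "C1_curve X \<A> c 0 1" "c 0 = p" "c 1 = q"
    "\<And>t. t \<in> {0..1} \<Longrightarrow> c t \<in> U \<and> \<phi> (c t) \<in> closed_segment (\<phi> p) (\<phi> q) \<and>
      ((\<phi> \<circ> c) has_vector_derivative \<phi> q - \<phi> p) (at t within {0..1})"
    using segment_C1_curve[OF U(1) seg, where \<alpha> = 0] U chart_inj[OF U(1)]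
    unfolding c_def by simp_all
  have pc: "piecewise_C1_curve X \<A> c 0 1"
    using c(1) by (rule piecewise_C1_curve_if_C1_curve) simp
  have cont: "continuous_map (top_of_set {0..1}) X c" by (rule piecewise_C1_curve_continuous[OF pc])
  have "curve_length \<A> g c 0 1 \<le> integral {0..1::real} (\<lambda>_. L)"
    unfolding curve_length_eq_integral_speed
  proof (rule integral_le[OF speed_integrable[OF pc]])
    fix t :: real assume t: "t \<in> {0..1}"
    have "speed c {0..1} t = sqrt (g (U, \<phi>) (c t) (\<phi> q - \<phi> p) (\<phi> q - \<phi> p))"
      using c(4)[of t] t by (intro speed_in_chart cont U) auto
    also have "\<dots> \<le> L" using c(4)[of t] t by (intro bound) auto
    finally show "speed c {0..1} t \<le> L" .
  qed auto
  also have "\<dots> = L" by simp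
  finally have "riemannian_dist X \<A> g (c 0) (c 1) \<le> L"
    using riemannian_dist_le[OF pc] by linarith
  then show ?thesis by (simp add: c(2,3))
qed

text \<open>A segment gives the upper bound. For the lower one, a competitor either stays in a
  larger ball of radius \<open>R\<close>, where the metric is nearly \<open>G\<close>, or comes in
  from its sphere, which is expensive enough. The last conclusion recovers the position in the chart
  from the distance alone.\<close>

lemma riemannian_dist_local_comparison:
  assumes conn: "connected_space X" and p0: "p0 \<in> topspace X" and \<epsilon>: "0 < \<epsilon>" "\<epsilon> < 1"
  obtains U \<phi> r \<rho> where "(U, \<phi>) \<in> \<A>" "p0 \<in> U" "r > 0" "\<rho> > 0"
    "\<And>p q. \<lbrakk>p \<in> U; q \<in> U; \<phi> p \<in> ball (\<phi> p0) r; \<phi> q \<in> ball (\<phi> p0) r\<rbrakk> \<Longrightarrow>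
      (1 - \<epsilon>) * sqrt (g (U, \<phi>) p0 (\<phi> p - \<phi> q) (\<phi> p - \<phi> q)) \<le> riemannian_dist X \<A> g p q \<and>
      riemannian_dist X \<A> g p q \<le> (1 + \<epsilon>) * sqrt (g (U, \<phi>) p0 (\<phi> p - \<phi> q) (\<phi> p - \<phi> q))"
    "\<And>q. \<lbrakk>q \<in> topspace X; riemannian_dist X \<A> g q p0 < \<rho>\<rbrakk> \<Longrightarrow> q \<in> U \<and> \<phi> q \<in> ball (\<phi> p0) r"
proof -
  obtain U \<phi> where U: "(U, \<phi>) \<in> \<A>" "p0 \<in> U" using ex_chart[OF p0] .
  define G where "G = g (U, \<phi>) p0"
  interpret G: inner_form G unfolding G_def by (rule inner_form_metric[OF U])
  let ?N = "\<lambda>v. sqrt (G v v)"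
  let ?x0 = "\<phi> p0"
  obtain m M where m: "m > 0" "M > 0" "\<And>v. m * norm v \<le> ?N v" "\<And>v. ?N v \<le> M * norm v"
    using G.norm_equivalent by blast
  obtain R where R: "R > 0" "cball ?x0 R \<subseteq> \<phi> ` U"
    and metric: "\<And>p v. p \<in> U \<Longrightarrow> \<phi> p \<in> cball ?x0 R \<Longrightarrow>
      (1 - \<epsilon>) * ?N v \<le> sqrt (g (U, \<phi>) p v v) \<and> sqrt (g (U, \<phi>) p v v) \<le> (1 + \<epsilon>) * ?N v"
    using metric_nearly_constant[OF U \<epsilon>] unfolding G_def by metis
  \<comment> \<open>The solution of \<open>2 * M * r = m * (R - r)\<close>: the left side bounds the
    \<open>G\<close>-diameter of the small ball, the right side bounds from below the
    \<open>G\<close>-length of any vector from radius \<open>R\<close> to radius at most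
    \<open>r\<close>.\<close>
  define r where "r = m * R / (2 * M + m)"
  have r: "r > 0" "r \<le> R" "2 * M * r = m * (R - r)"
  proof -
    show "r > 0" using m R by (simp add: r_def)
    have "2 * M + m > 0" using m by simp
    then show "2 * M * r = m * (R - r)" by (simp add: r_def field_simps)
    then have "m * (R - r) \<ge> 0" using m \<open>r > 0\<close> by (metis less_imp_le mult_nonneg_nonneg zero_le_numeral)
    then show "r \<le> R" using m by (simp add: zero_le_mult_iff)
  qed
  \<comment> \<open>The distance of the end point from the centre is kept, because the estimate
    serves twice: for end points in the small ball and for the centre itself.\<close>
  have lower: "(\<forall>t\<in>{\<alpha>..\<beta>}. c t \<in> U \<and> \<phi> (c t) \<in> ball ?x0 R) \<and>
        (1 - \<epsilon>) * ?N (\<phi> (c \<beta>) - \<phi> (c \<alpha>)) \<le> curve_length \<A> g c \<alpha> \<beta>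
      \<or> (1 - \<epsilon>) * (m * (R - dist ?x0 (\<phi> (c \<beta>)))) \<le> curve_length \<A> g c \<alpha> \<beta>"
    if c: "piecewise_C1_curve X \<A> c \<alpha> \<beta>" and "c \<beta> \<in> U" "\<phi> (c \<beta>) \<in> ball ?x0 R" for c \<alpha> \<beta>
  proof -
    have "\<alpha> < \<beta>" using c by (simp add: piecewise_C1_curve_def)
    from last_entry_time[OF U(1) R(2) piecewise_C1_curve_continuous[OF c] less_imp_le[OF this] that(2,3)]
    show ?thesis
    proof (elim disjE bexE conjE)
      assume stay: "\<forall>t\<in>{\<alpha>..\<beta>}. c t \<in> U \<and> \<phi> (c t) \<in> ball ?x0 R"
      have "(1 - \<epsilon>) * ?N (\<phi> (c \<beta>) - \<phi> (c \<alpha>)) \<le> curve_length \<A> g c \<alpha> \<beta>"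
        by (rule displacement_le_curve_length[OF c _ U(1) _ G.inner_form_axioms])
          (use stay metric \<epsilon> \<open>\<alpha> < \<beta>\<close> in \<open>auto simp: less_imp_le\<close>)
      then show ?thesis using stay by blast
    next
      fix T assume T: "T \<in> {\<alpha>..\<beta>}" "\<forall>t\<in>{T..\<beta>}. c t \<in> U \<and> \<phi> (c t) \<in> cball ?x0 R"
        "dist ?x0 (\<phi> (c T)) = R"
      have "(1 - \<epsilon>) * ?N (\<phi> (c \<beta>) - \<phi> (c T)) \<le> curve_length \<A> g c \<alpha> \<beta>"
        by (rule displacement_le_curve_length[OF c T(1) U(1) _ G.inner_form_axioms])
          (use T metric \<epsilon> in auto)
      moreover have "m * (R - dist ?x0 (\<phi> (c \<beta>))) \<le> ?N (\<phi> (c \<beta>) - \<phi> (c T))"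
      proof -
        have "R - dist ?x0 (\<phi> (c \<beta>)) \<le> norm (\<phi> (c \<beta>) - \<phi> (c T))"
          using T(3) dist_triangle[of ?x0 "\<phi> (c T)" "\<phi> (c \<beta>)"] by (simp add: dist_norm)
        then have "m * (R - dist ?x0 (\<phi> (c \<beta>))) \<le> m * norm (\<phi> (c \<beta>) - \<phi> (c T))"
          using m by (intro mult_left_mono) auto
        then show ?thesis using m(3) order_trans by blast
      qed
      then have "(1 - \<epsilon>) * (m * (R - dist ?x0 (\<phi> (c \<beta>)))) \<le> (1 - \<epsilon>) * ?N (\<phi> (c \<beta>) - \<phi> (c T))"
        using \<epsilon> by (intro mult_left_mono) auto
      ultimately show ?thesis by linarith
    qed
  qed
  show thesis
  \<comment> \<open>As \<open>\<rho>\<close> serves the cost of reaching the centre from outside the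
    small ball: at least \<open>m * r\<close> in \<open>G\<close>, lowered by the distortion
    \<open>1 - \<epsilon>\<close>.\<close>
  proof (rule that[OF U r(1), of "(1 - \<epsilon>) * (m * r)"])
    show "0 < (1 - \<epsilon>) * (m * r)" using \<epsilon> m r by simp
  next
    fix p q assume pq: "p \<in> U" "q \<in> U" "\<phi> p \<in> ball ?x0 r" "\<phi> q \<in> ball ?x0 r"
    have top: "p \<in> topspace X" "q \<in> topspace X" using pq chart_domain_subset[OF U(1)] by auto
    have dist_pq: "?N (\<phi> p - \<phi> q) \<le> 2 * M * r"
    proof -
      have "dist (\<phi> p) (\<phi> q) \<le> 2 * r"
        using pq dist_triangle3[of "\<phi> p" "\<phi> q" ?x0] by simp
      then have "M * norm (\<phi> p - \<phi> q) \<le> M * (2 * r)"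
        using m by (intro mult_left_mono) (auto simp: dist_norm)
      then show ?thesis using m(4)[of "\<phi> p - \<phi> q"] by simp
    qed
    have "(1 - \<epsilon>) * ?N (\<phi> p - \<phi> q) \<le> riemannian_dist X \<A> g p q"
    proof (rule le_riemannian_dist[OF conn top])
      fix c \<alpha> \<beta> assume c: "piecewise_C1_curve X \<A> c \<alpha> \<beta>" "c \<alpha> = p" "c \<beta> = q"
      have "m * (R - r) \<le> m * (R - dist ?x0 (\<phi> q))" using m pq by simp
      then have "(1 - \<epsilon>) * ?N (\<phi> p - \<phi> q) \<le> (1 - \<epsilon>) * (m * (R - dist ?x0 (\<phi> q)))"
        using dist_pq r(3) \<epsilon> by (intro mult_left_mono) linarith+
      then show "(1 - \<epsilon>) * ?N (\<phi> p - \<phi> q) \<le> curve_length \<A> g c \<alpha> \<beta>"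
        using lower[OF c(1)] c(2,3) pq r(2) G.minus_commute[of "\<phi> p" "\<phi> q"] by auto
    qed
    moreover have "riemannian_dist X \<A> g p q \<le> (1 + \<epsilon>) * ?N (\<phi> p - \<phi> q)"
    proof (rule riemannian_dist_le_in_chart[OF U(1) pq(1,2)])
      have seg: "closed_segment (\<phi> p) (\<phi> q) \<subseteq> cball ?x0 R"
        using closed_segment_subset[OF pq(3,4) convex_ball] r(2) by auto
      then show "closed_segment (\<phi> p) (\<phi> q) \<subseteq> \<phi> ` U" using R(2) by blast
      show "sqrt (g (U, \<phi>) p' (\<phi> q - \<phi> p) (\<phi> q - \<phi> p)) \<le> (1 + \<epsilon>) * ?N (\<phi> p - \<phi> q)"
        if "p' \<in> U" "\<phi> p' \<in> closed_segment (\<phi> p) (\<phi> q)" for p'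
        using metric[OF that(1), of "\<phi> q - \<phi> p"] that(2) seg G.minus_commute[of "\<phi> p" "\<phi> q"] by auto
    qed
    ultimately show "(1 - \<epsilon>) * sqrt (g (U, \<phi>) p0 (\<phi> p - \<phi> q) (\<phi> p - \<phi> q)) \<le> riemannian_dist X \<A> g p q \<and>
      riemannian_dist X \<A> g p q \<le> (1 + \<epsilon>) * sqrt (g (U, \<phi>) p0 (\<phi> p - \<phi> q) (\<phi> p - \<phi> q))"
      by (simp add: G_def)
  next
    fix q assume q: "q \<in> topspace X" "riemannian_dist X \<A> g q p0 < (1 - \<epsilon>) * (m * r)"
    show "q \<in> U \<and> \<phi> q \<in> ball ?x0 r"
    proof (rule ccontr)
      assume out: "\<not> ?thesis"
      have "(1 - \<epsilon>) * (m * r) \<le> riemannian_dist X \<A> g q p0"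
      proof (rule le_riemannian_dist[OF conn q(1) p0])
        fix c \<alpha> \<beta> assume c: "piecewise_C1_curve X \<A> c \<alpha> \<beta>" "c \<alpha> = q" "c \<beta> = p0"
        have "\<alpha> < \<beta>" using c by (simp add: piecewise_C1_curve_def)
        consider "q \<in> U" "(1 - \<epsilon>) * ?N (?x0 - \<phi> q) \<le> curve_length \<A> g c \<alpha> \<beta>"
          | "(1 - \<epsilon>) * (m * R) \<le> curve_length \<A> g c \<alpha> \<beta>"
          using lower[OF c(1)] c(2,3) U(2) R(1) \<open>\<alpha> < \<beta>\<close> by auto
        then show "(1 - \<epsilon>) * (m * r) \<le> curve_length \<A> g c \<alpha> \<beta>"
        proof cases
          case 1
          then have "r \<le> norm (?x0 - \<phi> q)" using out by (simp add: dist_norm)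
          then have "m * r \<le> m * norm (?x0 - \<phi> q)" using m by simp
          then have "m * r \<le> ?N (?x0 - \<phi> q)" using m(3) order_trans by blast
          then have "(1 - \<epsilon>) * (m * r) \<le> (1 - \<epsilon>) * ?N (?x0 - \<phi> q)" using \<epsilon> by (intro mult_left_mono) auto
          then show ?thesis using 1 by linarith
        next
          case 2
          have "(1 - \<epsilon>) * (m * r) \<le> (1 - \<epsilon>) * (m * R)" using \<epsilon> m r by (intro mult_left_mono) auto
          then show ?thesis using 2 by linarith
        qed
      qed
      then show False using q by simp
    qed
  qed
qed

end

section \<open>m-differentiable curves\<close>

text \<open>The substitution \<open>t' = t + s\<close> moves all limits to one fixed interval. As
  \<open>a < b\<close>, 0 is a limit point of the admissible increments, so \<open>Lim\<close> is
  the true limit and not an arbitrary value.\<close>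

lemma m_differentiable_tendsto:
  assumes "a < b" "t \<in> {a..b}" "m_differentiable d k a b \<gamma> t"
  shows "((\<lambda>t'. d (\<gamma> t') (\<gamma> t) / \<bar>t' - t\<bar> powr (1 / k)) \<longlongrightarrow>
    Lim (at 0 within {s. t + s \<in> {a..b}}) (m_quotient d k \<gamma> t)) (at t within {a..b})"
proof -
  let ?S = "{s. t + s \<in> {a..b}}"
  obtain l where l: "(m_quotient d k \<gamma> t \<longlongrightarrow> l) (at 0 within ?S)"
    using assms(3) unfolding m_differentiable_def by blast
  have "?S = {a - t..b - t}" by auto
  then have "0 islimpt ?S" using assms(1,2) by (simp add: islimpt_Icc)
  then have "Lim (at 0 within ?S) (m_quotient d k \<gamma> t) = l"
    using l by (intro tendsto_Lim) (auto simp: trivial_limit_within)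
  moreover have "((\<lambda>t'. d (\<gamma> t') (\<gamma> t) / \<bar>t' - t\<bar> powr (1 / k)) \<longlongrightarrow> l) (at t within {a..b})"
    unfolding Lim_within
  proof (intro allI impI)
    fix e :: real assume "e > 0"
    with l obtain \<delta> where \<delta>: "\<delta> > 0"
      "\<And>s. t + s \<in> {a..b} \<Longrightarrow> 0 < \<bar>s\<bar> \<Longrightarrow> \<bar>s\<bar> < \<delta> \<Longrightarrow> dist (m_quotient d k \<gamma> t s) l < e"
      unfolding Lim_within by (auto simp: dist_real_def)
    have "dist (d (\<gamma> t') (\<gamma> t) / \<bar>t' - t\<bar> powr (1 / k)) l < e"
      if "t' \<in> {a..b}" "0 < dist t' t \<and> dist t' t < \<delta>" for t'
      using \<delta>(2)[of "t' - t"] that by (simp add: m_quotient_def dist_real_def)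
    then show "\<exists>\<delta>>0. \<forall>t'\<in>{a..b}. 0 < dist t' t \<and> dist t' t < \<delta> \<longrightarrow>
        dist (d (\<gamma> t') (\<gamma> t) / \<bar>t' - t\<bar> powr (1 / k)) l < e"
      using \<delta>(1) by blast
  qed
  ultimately show ?thesis by simp
qed

lemma tendsto_abs_diff_powr_0:
  fixes \<alpha> t :: real
  assumes "\<alpha> > 0"
  shows "((\<lambda>t'. \<bar>t' - t\<bar> powr \<alpha>) \<longlongrightarrow> 0) (at t within S)"
proof -
  have "continuous_on UNIV (\<lambda>t'. \<bar>t' - t\<bar> powr \<alpha>)"
    by (intro continuous_on_powr' continuous_intros) (use assms in auto)
  then have "isCont (\<lambda>t'. \<bar>t' - t\<bar> powr \<alpha>) t"
    by (simp add: continuous_on_eq_continuous_at)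
  then have "((\<lambda>t'. \<bar>t' - t\<bar> powr \<alpha>) \<longlongrightarrow> 0) (at t)" by (simp add: isCont_def)
  then show ?thesis by (rule tendsto_within_subset) simp
qed

text \<open>\<open>(1 + \<epsilon>) / (1 - \<epsilon>)\<close> combines two errors: one of the chart
  comparison, one of the quotient against its limit. Squares appear because the estimates for
  snowflakes concern squared distances.\<close>

lemma ex_distortion:
  fixes \<eta> :: real
  assumes "\<eta> > 0"
  obtains \<epsilon> where "0 < \<epsilon>" "\<epsilon> < 1" "((1 + \<epsilon>) / (1 - \<epsilon>))\<^sup>2 \<le> 1 + \<eta>" "1 - \<eta> \<le> ((1 - \<epsilon>) / (1 + \<epsilon>))\<^sup>2"
proof -
  have "((\<lambda>e::real. ((1 + e) / (1 - e))\<^sup>2) \<longlongrightarrow> 1) (at_right 0)"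
    "((\<lambda>e::real. ((1 - e) / (1 + e))\<^sup>2) \<longlongrightarrow> 1) (at_right 0)"
    by (auto intro!: tendsto_eq_intros)
  then have "\<forall>\<^sub>F e in at_right (0::real). ((1 + e) / (1 - e))\<^sup>2 < 1 + \<eta>"
    "\<forall>\<^sub>F e in at_right (0::real). 1 - \<eta> < ((1 - e) / (1 + e))\<^sup>2"
    using assms by (auto intro: order_tendstoD)
  moreover have "\<forall>\<^sub>F e in at_right (0::real). e \<in> {0<..<1}"
    by (rule eventually_at_right_real) simp
  ultimately have "\<forall>\<^sub>F e in at_right (0::real). 0 < e \<and> e < 1 \<and>
      ((1 + e) / (1 - e))\<^sup>2 \<le> 1 + \<eta> \<and> 1 - \<eta> \<le> ((1 - e) / (1 + e))\<^sup>2"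
    by eventually_elim auto
  then show thesis using that eventually_happens'[OF trivial_limit_at_right_real] by blast
qed

theorem proposition2:
  fixes X :: "'a topology"
    and \<A> :: "('a, 'e::euclidean_space) chart set"
    and g :: "('a, 'e) chart \<Rightarrow> 'a \<Rightarrow> 'e \<Rightarrow> 'e \<Rightarrow> real"
    and k a b :: real
    and \<gamma> :: "real \<Rightarrow> 'a"
  assumes "riemannian_manifold X \<A> g"
    and "connected_space X"
    and "k \<ge> 1"
    and "a < b"
    and "m_C1 (topspace X) (riemannian_dist X \<A> g) k a b \<gamma>"
    and "\<exists>t\<in>{a..b}. meas (riemannian_dist X \<A> g) k a b \<gamma> t \<noteq> 0"
  shows "k = 1"
proof (rule ccontr)
  assume "k \<noteq> 1"
  with \<open>k \<ge> 1\<close> have k: "k > 1" by simp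
  interpret riemannian_manifold X \<A> g by fact
  define d where "d = riemannian_dist X \<A> g"
  have d_nonneg: "d p q \<ge> 0" for p q
    unfolding d_def by (rule riemannian_dist_nonneg[OF \<open>connected_space X\<close>])
  have p: "0 < 2 / k" "2 / k < 2" using k by (simp_all add: field_simps)
  \<comment> \<open>\<open>\<eta>\<close> depends on \<open>k\<close> and the dimension,
    \<open>\<epsilon>\<close> on \<open>\<eta>\<close>. Both precede the chart, whose useful radius
    depends on \<open>\<epsilon>\<close>.\<close>
  obtain \<eta> :: real where \<eta>: "0 < \<eta>" "\<eta> < 1"
    and no_snowflake: "\<And>(G :: 'e \<Rightarrow> 'e \<Rightarrow> real) K x u v.
      \<lbrakk>bilinear G; \<And>v w. G v w = G w v; K > 0; u < v; continuous_on {u..v} x;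
       \<And>t. t \<in> {u..v} \<Longrightarrow> \<exists>\<delta>>0. \<forall>t'\<in>{u..v}. \<bar>t' - t\<bar> < \<delta> \<longrightarrow>
         \<bar>G (x t' - x t) (x t' - x t) - K * \<bar>t' - t\<bar> powr (2 / k)\<bar> \<le> \<eta> * (K * \<bar>t' - t\<bar> powr (2 / k))\<rbrakk>
      \<Longrightarrow> False"
    using no_pointwise_near_snowflake[OF p, where 'e = 'e] by blast
  obtain \<epsilon> where \<epsilon>: "0 < \<epsilon>" "\<epsilon> < 1"
    "((1 + \<epsilon>) / (1 - \<epsilon>))\<^sup>2 \<le> 1 + \<eta>" "1 - \<eta> \<le> ((1 - \<epsilon>) / (1 + \<epsilon>))\<^sup>2"
    using ex_distortion[OF \<eta>(1)] .

  define Q where "Q t t' = d (\<gamma> t') (\<gamma> t) / \<bar>t' - t\<bar> powr (1 / k)" for t t'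
  define l where "l t = Lim (at 0 within {s. t + s \<in> {a..b}}) (m_quotient d k \<gamma> t)" for t
  have lim: "(Q t \<longlongrightarrow> l t) (at t within {a..b})" if "t \<in> {a..b}" for t
    unfolding Q_def l_def
    using assms(5) that by (intro m_differentiable_tendsto \<open>a < b\<close>) (auto simp: m_C1_def d_def)
  have nontriv: "at t within {a..b} \<noteq> bot" if "t \<in> {a..b}" for t
    using that \<open>a < b\<close> by (simp add: trivial_limit_within islimpt_Icc)
  have l_nonneg: "l t \<ge> 0" if "t \<in> {a..b}" for t
    by (rule tendsto_lowerbound[OF lim[OF that]]) (auto simp: Q_def d_nonneg nontriv[OF that])
  have meas_eq: "meas d k a b \<gamma> t = l t powr k" for t
    by (simp add: meas_def l_def)
  \<comment> \<open>\<open>l\<close> is recovered as the \<open>k\<close>-th root of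
    \<open>meas\<close>, which is legitimate because \<open>l\<close> is nonnegative.\<close>
  have l_cont: "continuous_on {a..b} l"
  proof -
    have "continuous_on {a..b} (\<lambda>t. meas d k a b \<gamma> t powr (1 / k))"
      using assms(5) k unfolding d_def[symmetric]
      by (intro continuous_on_powr' continuous_intros) (auto simp: m_C1_def meas_eq)
    then show ?thesis
      by (rule continuous_on_eq) (use k l_nonneg in \<open>auto simp: meas_eq powr_powr\<close>)
  qed
  have off_carrier: "l t = 0" if "t \<in> {a..b}" "\<gamma> t \<notin> topspace X" for t
  proof (rule tendsto_unique[OF nontriv[OF that(1)] lim[OF that(1)]])
    \<comment> \<open>\<open>riemannian_dist\<close> is 0 as soon as one argument is off the
      carrier. Hence a positive \<open>l t\<close> certifies
      \<open>\<gamma> t \<in> topspace X\<close>.\<close>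
    have "Q t = (\<lambda>_. 0)" using that by (auto simp: Q_def d_def riemannian_dist_def)
    then show "(Q t \<longlongrightarrow> 0) (at t within {a..b})" by simp
  qed

  obtain t0 where t0: "t0 \<in> {a..b}" "meas d k a b \<gamma> t0 \<noteq> 0"
    using assms(6) unfolding d_def by blast
  define L where "L = l t0"
  have L: "L > 0" using l_nonneg[OF t0(1)] t0(2) by (auto simp: L_def meas_eq less_le)
  have "\<gamma> t0 \<in> topspace X" using off_carrier[OF t0(1)] L by (auto simp: L_def)
  then obtain U \<phi> r \<rho> where U: "(U, \<phi>) \<in> \<A>" "\<gamma> t0 \<in> U" and "r > 0" "\<rho> > 0"
    and comparison: "\<And>p q. \<lbrakk>p \<in> U; q \<in> U; \<phi> p \<in> ball (\<phi> (\<gamma> t0)) r; \<phi> q \<in> ball (\<phi> (\<gamma> t0)) r\<rbrakk> \<Longrightarrow>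
      (1 - \<epsilon>) * sqrt (g (U, \<phi>) (\<gamma> t0) (\<phi> p - \<phi> q) (\<phi> p - \<phi> q)) \<le> d p q \<and>
      d p q \<le> (1 + \<epsilon>) * sqrt (g (U, \<phi>) (\<gamma> t0) (\<phi> p - \<phi> q) (\<phi> p - \<phi> q))"
    and near: "\<And>q. \<lbrakk>q \<in> topspace X; d q (\<gamma> t0) < \<rho>\<rbrakk> \<Longrightarrow> q \<in> U \<and> \<phi> q \<in> ball (\<phi> (\<gamma> t0)) r"
    using riemannian_dist_local_comparison[OF \<open>connected_space X\<close> _ \<epsilon>(1,2)] unfolding d_def by metis
  define G where "G = g (U, \<phi>) (\<gamma> t0)"
  interpret G: inner_form G unfolding G_def by (rule inner_form_metric[OF U])
  define x where "x t = \<phi> (\<gamma> t)" for t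
  let ?N = "\<lambda>v. sqrt (G v v)"

  have "\<forall>\<^sub>F t in at t0 within {a..b}. \<gamma> t \<in> U \<and> x t \<in> ball (x t0) r \<and> \<bar>l t - L\<bar> < \<epsilon> * L / 2"
  proof -
    \<comment> \<open>For \<open>t \<noteq> t0\<close> the product is the distance from
      \<open>\<gamma> t\<close> to \<open>\<gamma> t0\<close>, so \<open>near\<close> can place
      \<open>\<gamma> t\<close> in the chart.\<close>
    have "((\<lambda>t. Q t0 t * \<bar>t - t0\<bar> powr (1 / k)) \<longlongrightarrow> l t0 * 0) (at t0 within {a..b})"
      using k by (intro tendsto_mult lim t0 tendsto_abs_diff_powr_0) simp
    then have "\<forall>\<^sub>F t in at t0 within {a..b}. Q t0 t * \<bar>t - t0\<bar> powr (1 / k) < \<rho>"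
      using \<open>\<rho> > 0\<close> by (intro order_tendstoD) auto
    moreover have "(l \<longlongrightarrow> L) (at t0 within {a..b})"
      using l_cont t0(1) by (auto simp: continuous_on_def L_def)
    then have "\<forall>\<^sub>F t in at t0 within {a..b}. dist (l t) L < \<epsilon> * L / 2"
      using \<epsilon> L by (intro tendstoD) auto
    moreover have "\<forall>\<^sub>F t in at t0 within {a..b}. t \<in> {a..b} \<and> t \<noteq> t0"
      by (auto simp: eventually_at_filter)
    ultimately show ?thesis
    proof eventually_elim
      case (elim t)
      have "l t \<noteq> 0"
      proof
        assume "l t = 0"
        moreover have "\<epsilon> * L \<le> 1 * L" using \<epsilon> L by (intro mult_right_mono) auto
        ultimately show False using elim(2) L by (simp add: dist_real_def)
      qed
      then have "\<gamma> t \<in> topspace X" using off_carrier[of t] elim(3) by blast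
      moreover have "d (\<gamma> t) (\<gamma> t0) < \<rho>" using elim(1,3) by (simp add: Q_def)
      ultimately show ?case using near elim(2) by (simp add: x_def dist_real_def)
    qed
  qed
  then obtain \<delta>0 where \<delta>0: "\<delta>0 > 0" "\<And>t. t \<in> {a..b} \<Longrightarrow> t \<noteq> t0 \<Longrightarrow> \<bar>t - t0\<bar> < \<delta>0 \<Longrightarrow>
      \<gamma> t \<in> U \<and> x t \<in> ball (x t0) r \<and> \<bar>l t - L\<bar> < \<epsilon> * L / 2"
    unfolding eventually_at by (auto simp: dist_real_def)
  \<comment> \<open>\<open>t0\<close> may be an end point of \<open>{a..b}\<close>; then
    \<open>{u..v}\<close> extends to one side only, but it is still nondegenerate.\<close>
  define u where "u = max a (t0 - \<delta>0 / 2)"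
  define v where "v = min b (t0 + \<delta>0 / 2)"
  have "u < v" using \<open>a < b\<close> t0(1) \<delta>0(1) by (auto simp: u_def v_def)
  have sub: "{u..v} \<subseteq> {a..b}" by (auto simp: u_def v_def)
  have chart: "\<gamma> t \<in> U \<and> x t \<in> ball (x t0) r \<and> \<bar>l t - L\<bar> < \<epsilon> * L / 2" if t: "t \<in> {u..v}" for t
  proof (cases "t = t0")
    case True
    then show ?thesis using U \<open>r > 0\<close> \<epsilon> L by (simp add: L_def)
  next
    case False
    then show ?thesis using \<delta>0 t sub by (intro \<delta>0(2)) (auto simp: u_def v_def)
  qed

  have bounds: "\<exists>\<delta>>0. \<forall>t'\<in>{u..v}. \<bar>t' - t\<bar> < \<delta> \<longrightarrow>
      (1 - \<epsilon>) / (1 + \<epsilon>) * L * \<bar>t' - t\<bar> powr (1 / k) \<le> ?N (x t' - x t) \<and>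
      ?N (x t' - x t) \<le> (1 + \<epsilon>) / (1 - \<epsilon>) * L * \<bar>t' - t\<bar> powr (1 / k)"
    if t: "t \<in> {u..v}" for t
  proof -
    \<comment> \<open>The tolerance \<open>\<epsilon> * L\<close> is shared equally between
      \<open>Q t t'\<close> against \<open>l t\<close> and \<open>l t\<close> against
      \<open>L\<close>. The second half is uniform on \<open>{u..v}\<close>, the first gives a
      \<open>\<delta>\<close> depending on \<open>t\<close>.\<close>
    have "\<forall>\<^sub>F t' in at t within {a..b}. dist (Q t t') (l t) < \<epsilon> * L / 2"
      using t sub \<epsilon> L by (intro tendstoD[OF lim]) auto
    then obtain \<delta> where \<delta>: "\<delta> > 0" "\<And>t'. t' \<in> {a..b} \<Longrightarrow> t' \<noteq> t \<Longrightarrow> \<bar>t' - t\<bar> < \<delta> \<Longrightarrow>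
        \<bar>Q t t' - l t\<bar> < \<epsilon> * L / 2"
      unfolding eventually_at by (auto simp: dist_real_def)
    have "(1 - \<epsilon>) / (1 + \<epsilon>) * L * \<bar>t' - t\<bar> powr (1 / k) \<le> ?N (x t' - x t) \<and>
      ?N (x t' - x t) \<le> (1 + \<epsilon>) / (1 - \<epsilon>) * L * \<bar>t' - t\<bar> powr (1 / k)"
      if t': "t' \<in> {u..v}" "\<bar>t' - t\<bar> < \<delta>" for t'
    proof (cases "t' = t")
      case True
      then show ?thesis by (simp add: bilinear_lzero[OF G.bilinear])
    next
      case False
      let ?w = "\<bar>t' - t\<bar> powr (1 / k)"
      let ?D = "d (\<gamma> t') (\<gamma> t)"
      have w: "?w > 0" using False by simp
      have "\<bar>Q t t' - l t\<bar> < \<epsilon> * L / 2" using t' sub False by (intro \<delta>(2)) auto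
      moreover have "\<bar>l t - L\<bar> < \<epsilon> * L / 2" using chart[OF t] by blast
      ultimately have "\<bar>Q t t' - L\<bar> < \<epsilon> * L" by linarith
      then have "(1 - \<epsilon>) * L \<le> ?D / ?w" "?D / ?w \<le> (1 + \<epsilon>) * L"
        unfolding Q_def left_diff_distrib distrib_right by linarith+
      then have D: "(1 - \<epsilon>) * L * ?w \<le> ?D" "?D \<le> (1 + \<epsilon>) * L * ?w"
        using w by (simp_all add: pos_le_divide_eq pos_divide_le_eq)
      have C: "(1 - \<epsilon>) * ?N (x t' - x t) \<le> ?D" "?D \<le> (1 + \<epsilon>) * ?N (x t' - x t)"
        using comparison[of "\<gamma> t'" "\<gamma> t"] chart[OF t] chart[OF t'(1)] by (auto simp: x_def G_def)
      show ?thesis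
        using order_trans[OF D(1) C(2)] order_trans[OF C(1) D(2)] \<epsilon>(1,2)
        by (simp add: pos_le_divide_eq pos_divide_le_eq mult_ac)
    qed
    with \<delta>(1) show ?thesis by blast
  qed

  obtain m where m: "m > 0" "\<And>v. m * norm v \<le> ?N v"
    using G.norm_equivalent by metis
  show False
  proof (rule no_snowflake[OF G.bilinear G.sym, of "L\<^sup>2" u v x])
    show "0 < L\<^sup>2" "u < v" using L \<open>u < v\<close> by auto
    show "continuous_on {u..v} x"
      unfolding continuous_on_def
    proof
      fix t assume t: "t \<in> {u..v}"
      \<comment> \<open>The upper half of \<open>bounds\<close> is a Hoelder estimate at
        \<open>t\<close>; division by \<open>m\<close> passes from \<open>G\<close> to the norm and
        yields continuity of \<open>x\<close>.\<close>
      let ?C = "(1 + \<epsilon>) / (1 - \<epsilon>) * L / m"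
      have "\<forall>\<^sub>F t' in at t within {u..v}. norm (x t' - x t) \<le> ?C * \<bar>t' - t\<bar> powr (1 / k)"
      proof -
        obtain \<delta> where \<delta>: "\<delta> > 0" "\<forall>t'\<in>{u..v}. \<bar>t' - t\<bar> < \<delta> \<longrightarrow>
            ?N (x t' - x t) \<le> (1 + \<epsilon>) / (1 - \<epsilon>) * L * \<bar>t' - t\<bar> powr (1 / k)"
          using bounds[OF t] by blast
        have "norm (x t' - x t) \<le> ?C * \<bar>t' - t\<bar> powr (1 / k)" if "t' \<in> {u..v}" "\<bar>t' - t\<bar> < \<delta>" for t'
        proof -
          have "m * norm (x t' - x t) \<le> (1 + \<epsilon>) / (1 - \<epsilon>) * L * \<bar>t' - t\<bar> powr (1 / k)"
            using m(2)[of "x t' - x t"] \<delta>(2) that by (blast intro: order_trans)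
          then have "norm (x t' - x t) \<le> (1 + \<epsilon>) / (1 - \<epsilon>) * L * \<bar>t' - t\<bar> powr (1 / k) / m"
            using m(1) by (metis mult.commute pos_le_divide_eq)
          then show ?thesis by simp
        qed
        then show ?thesis unfolding eventually_at using \<delta>(1) by (auto simp: dist_real_def)
      qed
      moreover have "((\<lambda>t'. ?C * \<bar>t' - t\<bar> powr (1 / k)) \<longlongrightarrow> 0) (at t within {u..v})"
        using k by (intro tendsto_mult_right_zero tendsto_abs_diff_powr_0) simp
      ultimately have "((\<lambda>t'. x t' - x t) \<longlongrightarrow> 0) (at t within {u..v})"
        by (rule Lim_null_comparison)
      then show "(x \<longlongrightarrow> x t) (at t within {u..v})" by (simp add: LIM_zero_iff)
    qed
    fix t assume t: "t \<in> {u..v}"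
    have "\<bar>G (x t' - x t) (x t' - x t) - L\<^sup>2 * \<bar>t' - t\<bar> powr (2 / k)\<bar> \<le> \<eta> * (L\<^sup>2 * \<bar>t' - t\<bar> powr (2 / k))"
      if "(1 - \<epsilon>) / (1 + \<epsilon>) * L * \<bar>t' - t\<bar> powr (1 / k) \<le> ?N (x t' - x t)"
        "?N (x t' - x t) \<le> (1 + \<epsilon>) / (1 - \<epsilon>) * L * \<bar>t' - t\<bar> powr (1 / k)" for t'
    proof -
      let ?K = "L\<^sup>2 * \<bar>t' - t\<bar> powr (2 / k)"
      have w2: "(\<bar>t' - t\<bar> powr (1 / k))\<^sup>2 = \<bar>t' - t\<bar> powr (2 / k)"
        by (simp add: power2_eq_square flip: powr_add)
      have "((1 - \<epsilon>) / (1 + \<epsilon>) * L * \<bar>t' - t\<bar> powr (1 / k))\<^sup>2 \<le> (?N (x t' - x t))\<^sup>2"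
        "(?N (x t' - x t))\<^sup>2 \<le> ((1 + \<epsilon>) / (1 - \<epsilon>) * L * \<bar>t' - t\<bar> powr (1 / k))\<^sup>2"
        by (intro power_mono that; use \<epsilon>(1,2) L in \<open>simp add: G.nonneg\<close>)+
      then have "((1 - \<epsilon>) / (1 + \<epsilon>))\<^sup>2 * ?K \<le> G (x t' - x t) (x t' - x t)"
        "G (x t' - x t) (x t' - x t) \<le> ((1 + \<epsilon>) / (1 - \<epsilon>))\<^sup>2 * ?K"
        unfolding power_mult_distrib w2 by (simp_all only: G.nonneg real_sqrt_pow2 mult.assoc)
      moreover have "(1 - \<eta>) * ?K \<le> ((1 - \<epsilon>) / (1 + \<epsilon>))\<^sup>2 * ?K" "((1 + \<epsilon>) / (1 - \<epsilon>))\<^sup>2 * ?K \<le> (1 + \<eta>) * ?K"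
        using \<epsilon>(3,4) by (auto intro!: mult_right_mono)
      ultimately show ?thesis unfolding left_diff_distrib distrib_right by linarith
    qed
    then show "\<exists>\<delta>>0. \<forall>t'\<in>{u..v}. \<bar>t' - t\<bar> < \<delta> \<longrightarrow>
      \<bar>G (x t' - x t) (x t' - x t) - L\<^sup>2 * \<bar>t' - t\<bar> powr (2 / k)\<bar> \<le> \<eta> * (L\<^sup>2 * \<bar>t' - t\<bar> powr (2 / k))"
      using bounds[OF t] by meson
  qed
qed

end
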